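(* The Banach spaces $L_2 + L_\infty$ and $L_2 \cap L_\infty$ of functions on $(0,\infty)$ are not isomorphic.
   Context: All function spaces are over the half-line $(0,\infty)$ with Lebesgue measure, functions equal almost everywhere being identified. $L_2 = L_2(0,\infty)$ has the norm $\|x\|_{L_2} = \left(\int_0^\infty |x(t)|^2\,dt\right)^{1/2}$, and $L_\infty = L_\infty(0,\infty)$ has the norm $\|x\|_{L_\infty} = \operatorname{ess\,sup}_{t>0} |x(t)|$. The space $L_2 + L_\infty$ consists of all measurable functions $x$ on $(0,\infty)$ of the form $x = u + v$ with $u \in L_2$, $v \in L_\infty$, with the norm $$\|x\|_{L_2+L_\infty} = \inf\{\|u\|_{L_2} + \|v\|_{L_\infty} : x = u + v,\ u \in L_2,\ v \in L_\infty\}.$$ The space $L_2 \cap L_\infty$ consists of all functions belonging to both $L_2$ and $L_\infty$, with the norm $$\|x\|_{L_2 \cap L_\infty} = \max\{\|x\|_{L_2}, \|x\|_{L_\infty}\}.$$ Two Banach spaces are isomorphic if there is a bounded linear bijection between them with bounded inverse (not necessarily isometric). *)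

theory Defs
  imports "HOL-Analysis.Analysis" "HOL-Probability.Essential_Supremum"
begin

section \<open>Measurable functions on the half-line modulo null sets\<close>

abbreviation half_line :: "real measure"
  where "half_line \<equiv> lebesgue_on {0<..}"

text \<open>The relation is partial: representatives are the Lebesgue measurable functions, whose
  values outside \<open>(0, \<infinity>)\<close> are irrelevant.\<close>

quotient_type L0 = "real \<Rightarrow> real" / partial:
  "\<lambda>f g. f \<in> borel_measurable half_line \<and> g \<in> borel_measurable half_line \<and>
         (AE t in half_line. f t = g t)"
proof (rule part_equivpI)
  show "\<exists>f::real \<Rightarrow> real. f \<in> borel_measurable half_line \<and> f \<in> borel_measurable half_line \<and>
         (AE t in half_line. f t = f t)"
    by (rule exI[of _ "\<lambda>_. 0"]) simp
  show "symp (\<lambda>f g :: real \<Rightarrow> real. f \<in> borel_measurable half_line \<and>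
         g \<in> borel_measurable half_line \<and> (AE t in half_line. f t = g t))"
    by (rule sympI) (auto elim: eventually_mono)
  show "transp (\<lambda>f g :: real \<Rightarrow> real. f \<in> borel_measurable half_line \<and>
         g \<in> borel_measurable half_line \<and> (AE t in half_line. f t = g t))"
  proof (rule transpI, elim conjE, intro conjI)
    fix f g h :: "real \<Rightarrow> real"
    assume "AE t in half_line. f t = g t" "AE t in half_line. g t = h t"
    then show "AE t in half_line. f t = h t" by eventually_elim simp
  qed
qed

instantiation L0 :: real_vector
begin

lift_definition zero_L0 :: L0 is "\<lambda>_. 0" by simp

lift_definition plus_L0 :: "L0 \<Rightarrow> L0 \<Rightarrow> L0" is "\<lambda>f g t. f t + g t"
  by (auto elim: eventually_elim2)

lift_definition uminus_L0 :: "L0 \<Rightarrow> L0" is "\<lambda>f t. - f t"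
  by (auto elim: eventually_mono)

lift_definition minus_L0 :: "L0 \<Rightarrow> L0 \<Rightarrow> L0" is "\<lambda>f g t. f t - g t"
  by (auto elim: eventually_elim2)

lift_definition scaleR_L0 :: "real \<Rightarrow> L0 \<Rightarrow> L0" is "\<lambda>c f t. c * f t"
  by (auto elim: eventually_mono)

instance
  by (standard; transfer; simp add: algebra_simps)

end


section \<open>The spaces \<open>L2\<close> and \<open>L_infinity\<close>\<close>

lift_definition sq_integrable :: "L0 \<Rightarrow> bool"
  is "\<lambda>f. integrable half_line (\<lambda>t. \<bar>f t\<bar>\<^sup>2)"
proof (elim conjE)
  fix f g :: "real \<Rightarrow> real"
  assume [measurable]: "f \<in> borel_measurable half_line" "g \<in> borel_measurable half_line"
    and "AE t in half_line. f t = g t"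
  then show "integrable half_line (\<lambda>t. \<bar>f t\<bar>\<^sup>2) = integrable half_line (\<lambda>t. \<bar>g t\<bar>\<^sup>2)"
    by (intro integrable_cong_AE) auto
qed

lift_definition L2_norm :: "L0 \<Rightarrow> real"
  is "\<lambda>f. sqrt (\<integral>t. \<bar>f t\<bar>\<^sup>2 \<partial>half_line)"
proof (elim conjE)
  fix f g :: "real \<Rightarrow> real"
  assume [measurable]: "f \<in> borel_measurable half_line" "g \<in> borel_measurable half_line"
    and "AE t in half_line. f t = g t"
  then have "(\<integral>t. \<bar>f t\<bar>\<^sup>2 \<partial>half_line) = (\<integral>t. \<bar>g t\<bar>\<^sup>2 \<partial>half_line)"
    by (intro integral_cong_AE) auto
  then show "sqrt (\<integral>t. \<bar>f t\<bar>\<^sup>2 \<partial>half_line) = sqrt (\<integral>t. \<bar>g t\<bar>\<^sup>2 \<partial>half_line)"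
    by simp
qed

lift_definition abs_esssup :: "L0 \<Rightarrow> ereal"
  is "\<lambda>f. esssup half_line (\<lambda>t. ereal \<bar>f t\<bar>)"
proof (elim conjE)
  fix f g :: "real \<Rightarrow> real"
  assume [measurable]: "f \<in> borel_measurable half_line" "g \<in> borel_measurable half_line"
    and "AE t in half_line. f t = g t"
  then show "esssup half_line (\<lambda>t. ereal \<bar>f t\<bar>) = esssup half_line (\<lambda>t. ereal \<bar>g t\<bar>)"
    by (intro esssup_AE_cong) auto
qed

definition L2 :: "L0 set"
  where "L2 = {x. sq_integrable x}"

definition Linf :: "L0 set"
  where "Linf = {x. abs_esssup x < \<infinity>}"

definition Linf_norm :: "L0 \<Rightarrow> real"
  where "Linf_norm x = real_of_ereal (abs_esssup x)"

lemma half_line_nonnull: "emeasure half_line (space half_line) \<noteq> 0"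
proof -
  have "emeasure lebesgue {0<..<1::real} \<le> emeasure lebesgue {0::real<..}"
    by (intro emeasure_mono) auto
  then show ?thesis
    by (auto simp: emeasure_restrict_space)
qed

lemma L2_norm_nonneg [simp]: "0 \<le> L2_norm x"
  by transfer simp

lemma L2_zero [simp]: "0 \<in> L2" and L2_norm_zero [simp]: "L2_norm 0 = 0"
  by (simp_all add: L2_def) (transfer, simp)+

lemma L2_scaleR: "x \<in> L2 \<Longrightarrow> c *\<^sub>R x \<in> L2"
  unfolding L2_def mem_Collect_eq by transfer (simp add: power_mult_distrib)

lemma L2_norm_scaleR: "L2_norm (c *\<^sub>R x) = \<bar>c\<bar> * L2_norm x"
  by transfer (simp add: power_mult_distrib real_sqrt_mult)

lemma sq_integrable_mult:
  fixes f g :: "'a \<Rightarrow> real"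
  assumes [measurable]: "f \<in> borel_measurable M" "g \<in> borel_measurable M"
    and "integrable M (\<lambda>t. (f t)\<^sup>2)" "integrable M (\<lambda>t. (g t)\<^sup>2)"
  shows "integrable M (\<lambda>t. f t * g t)"
proof (rule Bochner_Integration.integrable_bound)
  show "integrable M (\<lambda>t. (f t)\<^sup>2 + (g t)\<^sup>2)"
    using assms by simp
  have "\<bar>a * b\<bar> \<le> a\<^sup>2 + b\<^sup>2" for a b :: real
    using sum_squares_bound[of a b] sum_squares_bound[of a "-b"]
    by (simp add: abs_le_iff)
  then show "AE t in M. norm (f t * g t) \<le> norm ((f t)\<^sup>2 + (g t)\<^sup>2)"
    by (auto intro!: AE_I2)
qed simp

lemma sq_integral_add:
  fixes f g :: "'a \<Rightarrow> real"
  assumes [measurable]: "f \<in> borel_measurable M" "g \<in> borel_measurable M"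
    and f: "integrable M (\<lambda>t. (f t)\<^sup>2)" and g: "integrable M (\<lambda>t. (g t)\<^sup>2)"
  shows "integrable M (\<lambda>t. (f t + g t)\<^sup>2)"
    and "sqrt (\<integral>t. (f t + g t)\<^sup>2 \<partial>M) \<le> sqrt (\<integral>t. (f t)\<^sup>2 \<partial>M) + sqrt (\<integral>t. (g t)\<^sup>2 \<partial>M)"
proof -
  define A B P where "A = (\<integral>t. (f t)\<^sup>2 \<partial>M)" "B = (\<integral>t. (g t)\<^sup>2 \<partial>M)" "P = (\<integral>t. f t * g t \<partial>M)"
  note fg = sq_integrable_mult[OF assms]
  have eq: "(f t + c * g t)\<^sup>2 = (f t)\<^sup>2 + 2 * c * (f t * g t) + c\<^sup>2 * (g t)\<^sup>2" for c t
    by (simp add: power2_eq_square algebra_simps)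
  have int: "integrable M (\<lambda>t. (f t + c * g t)\<^sup>2)" for c
    unfolding eq using f g fg by simp
  have val: "(\<integral>t. (f t + c * g t)\<^sup>2 \<partial>M) = A + 2 * c * P + c\<^sup>2 * B" for c
    unfolding eq A_B_P_def using f g fg by simp
  have nonneg: "0 \<le> A + 2 * c * P + c\<^sup>2 * B" for c
    unfolding val[symmetric] by simp
  have AB: "0 \<le> A" "0 \<le> B"
    unfolding A_B_P_def by simp_all
  have "P\<^sup>2 \<le> A * B"
  proof (cases "B = 0")
    case True
    have "P = 0"
    proof (rule ccontr)
      assume "P \<noteq> 0"
      then show False
        using nonneg[of "- (A + 1) / (2 * P)"] AB True by (simp add: field_simps)
    qed
    then show ?thesis using AB by simp
  next
    case False
    then show ?thesis
      using nonneg[of "- P / B"] AB by (simp add: field_simps power2_eq_square)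
  qed
  then have "P \<le> sqrt A * sqrt B"
    by (metis real_le_rsqrt real_sqrt_mult)
  then have "A + 2 * P + B \<le> (sqrt A + sqrt B)\<^sup>2"
    using AB by (simp add: power2_sum)
  then have "sqrt (A + 2 * P + B) \<le> sqrt A + sqrt B"
    using AB by (intro real_le_lsqrt) auto
  with val[of 1] show "sqrt (\<integral>t. (f t + g t)\<^sup>2 \<partial>M)
      \<le> sqrt (\<integral>t. (f t)\<^sup>2 \<partial>M) + sqrt (\<integral>t. (g t)\<^sup>2 \<partial>M)"
    by (simp add: A_B_P_def)
  show "integrable M (\<lambda>t. (f t + g t)\<^sup>2)"
    using int[of 1] by simp
qed

lemma L2_add: "x \<in> L2 \<Longrightarrow> y \<in> L2 \<Longrightarrow> x + y \<in> L2"
  unfolding L2_def mem_Collect_eq by transfer (simp add: sq_integral_add(1))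

lemma L2_norm_triangle: "x \<in> L2 \<Longrightarrow> y \<in> L2 \<Longrightarrow> L2_norm (x + y) \<le> L2_norm x + L2_norm y"
  unfolding L2_def mem_Collect_eq by transfer (simp add: sq_integral_add(2))

lemma L2_norm_eq_0: "x \<in> L2 \<Longrightarrow> L2_norm x = 0 \<longleftrightarrow> x = 0"
  unfolding L2_def mem_Collect_eq by transfer (simp add: integral_nonneg_eq_0_iff_AE)

lemma Linf_iff: "x \<in> Linf \<longleftrightarrow> (\<exists>c. abs_esssup x \<le> ereal c)"
  unfolding Linf_def by (cases "abs_esssup x") auto

lemma abs_esssup_nonneg: "0 \<le> abs_esssup x"
proof transfer
  fix f :: "real \<Rightarrow> real"
  assume "f \<in> borel_measurable half_line \<and> f \<in> borel_measurable half_line \<and>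
    (AE t in half_line. f t = f t)"
  then have [measurable]: "f \<in> borel_measurable half_line" by simp
  have "esssup half_line (\<lambda>t. 0 :: ereal) \<le> esssup half_line (\<lambda>t. ereal \<bar>f t\<bar>)"
    by (rule esssup_mono) auto
  then show "0 \<le> esssup half_line (\<lambda>t. ereal \<bar>f t\<bar>)"
    using esssup_const[OF half_line_nonnull, of "0 :: ereal"] by simp
qed

lemma abs_esssup_eq: "x \<in> Linf \<Longrightarrow> abs_esssup x = ereal (Linf_norm x)"
  using abs_esssup_nonneg[of x] unfolding Linf_def Linf_norm_def
  by (cases "abs_esssup x") auto

lemma Linf_norm_nonneg [simp]: "0 \<le> Linf_norm x"
  unfolding Linf_norm_def by (simp add: abs_esssup_nonneg real_of_ereal_pos)

lemma abs_esssup_add: "abs_esssup (x + y) \<le> abs_esssup x + abs_esssup y"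
proof transfer
  fix f g :: "real \<Rightarrow> real"
  assume "f \<in> borel_measurable half_line \<and> f \<in> borel_measurable half_line \<and>
      (AE t in half_line. f t = f t)"
    and "g \<in> borel_measurable half_line \<and> g \<in> borel_measurable half_line \<and>
      (AE t in half_line. g t = g t)"
  then have [measurable]: "f \<in> borel_measurable half_line" "g \<in> borel_measurable half_line"
    by simp_all
  have "esssup half_line (\<lambda>t. ereal \<bar>f t + g t\<bar>)
      \<le> esssup half_line (\<lambda>t. ereal \<bar>f t\<bar> + ereal \<bar>g t\<bar>)"
    by (rule esssup_mono) auto
  also have "\<dots> \<le> esssup half_line (\<lambda>t. ereal \<bar>f t\<bar>) + esssup half_line (\<lambda>t. ereal \<bar>g t\<bar>)"
    by (rule esssup_add)
  finally show "esssup half_line (\<lambda>t. ereal \<bar>f t + g t\<bar>)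
      \<le> esssup half_line (\<lambda>t. ereal \<bar>f t\<bar>) + esssup half_line (\<lambda>t. ereal \<bar>g t\<bar>)" .
qed

lemma abs_esssup_zero: "abs_esssup 0 = 0"
  by transfer (use esssup_const[OF half_line_nonnull, of "0 :: ereal"] in \<open>simp add: zero_ereal_def\<close>)

lemma abs_esssup_scaleR: "c \<noteq> 0 \<Longrightarrow> abs_esssup (c *\<^sub>R x) = ereal \<bar>c\<bar> * abs_esssup x"
proof transfer
  fix c :: real and f :: "real \<Rightarrow> real"
  assume "c \<noteq> 0"
  then show "esssup half_line (\<lambda>t. ereal \<bar>c * f t\<bar>)
      = ereal \<bar>c\<bar> * esssup half_line (\<lambda>t. ereal \<bar>f t\<bar>)"
    using esssup_cmult[of "\<bar>c\<bar>" half_line "\<lambda>t. ereal \<bar>f t\<bar>"] by (simp add: abs_mult)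
qed

lemma Linf_zero [simp]: "0 \<in> Linf" and Linf_norm_zero [simp]: "Linf_norm 0 = 0"
  by (simp_all add: Linf_def Linf_norm_def abs_esssup_zero)

lemma Linf_scaleR: "x \<in> Linf \<Longrightarrow> c *\<^sub>R x \<in> Linf"
  by (cases "c = 0") (auto simp: Linf_iff[of "c *\<^sub>R x"] abs_esssup_scaleR abs_esssup_eq)

lemma Linf_norm_scaleR: "Linf_norm (c *\<^sub>R x) = \<bar>c\<bar> * Linf_norm x"
  by (cases "c = 0") (simp_all add: Linf_norm_def abs_esssup_scaleR abs_esssup_zero)

lemma Linf_add: "x \<in> Linf \<Longrightarrow> y \<in> Linf \<Longrightarrow> x + y \<in> Linf"
  using abs_esssup_add[of x y] by (auto simp: Linf_iff[of "x + y"] abs_esssup_eq)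

lemma Linf_norm_triangle:
  "x \<in> Linf \<Longrightarrow> y \<in> Linf \<Longrightarrow> Linf_norm (x + y) \<le> Linf_norm x + Linf_norm y"
  using abs_esssup_add[of x y] Linf_add[of x y] by (simp add: abs_esssup_eq)

lemma Linf_norm_le_iff: "x \<in> Linf \<and> Linf_norm x \<le> c \<longleftrightarrow> abs_esssup x \<le> ereal c"
  by (metis Linf_iff abs_esssup_eq ereal_less_eq(3))

lemma Linf_norm_eq_0: "x \<in> Linf \<Longrightarrow> Linf_norm x = 0 \<longleftrightarrow> x = 0"
proof
  assume "x \<in> Linf" "Linf_norm x = 0"
  then have "abs_esssup x \<le> 0"
    by (simp add: abs_esssup_eq)
  then show "x = 0"
  proof transfer
    fix f :: "real \<Rightarrow> real"
    assume f: "f \<in> borel_measurable half_line \<and> f \<in> borel_measurable half_line \<and>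
        (AE t in half_line. f t = f t)" and "esssup half_line (\<lambda>t. ereal \<bar>f t\<bar>) \<le> 0"
    have "AE t in half_line. f t = 0"
      using esssup_AE[of "\<lambda>t. ereal \<bar>f t\<bar>" half_line]
    proof eventually_elim
      case (elim t)
      then have "ereal \<bar>f t\<bar> \<le> 0"
        using \<open>esssup half_line (\<lambda>t. ereal \<bar>f t\<bar>) \<le> 0\<close> by (rule order_trans)
      then show ?case by simp
    qed
    with f show "f \<in> borel_measurable half_line \<and> (\<lambda>_. 0) \<in> borel_measurable half_line \<and>
        (AE t in half_line. f t = 0)"
      by simp
  qed
qed simp


section \<open>The spaces \<open>L2 + L_infinity\<close> and \<open>L2 \<inter> L_infinity\<close>\<close>

definition L2_sum_Linf :: "L0 set"
  where "L2_sum_Linf = {u + v | u v. u \<in> L2 \<and> v \<in> Linf}"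

definition sum_norm :: "L0 \<Rightarrow> real"
  where "sum_norm x = Inf {L2_norm u + Linf_norm v | u v. x = u + v \<and> u \<in> L2 \<and> v \<in> Linf}"

definition cap_norm :: "L0 \<Rightarrow> real"
  where "cap_norm x = max (L2_norm x) (Linf_norm x)"

typedef L2_plus_Linf = L2_sum_Linf
  unfolding L2_sum_Linf_def using L2_zero Linf_zero by blast

typedef L2_cap_Linf = "L2 \<inter> Linf"
  using L2_zero Linf_zero by blast

setup_lifting type_definition_L2_plus_Linf
setup_lifting type_definition_L2_cap_Linf

lemma L2_uminus: "x \<in> L2 \<Longrightarrow> - x \<in> L2"
  using L2_scaleR[of x "-1"] by simp

lemma Linf_uminus: "x \<in> Linf \<Longrightarrow> - x \<in> Linf"
  using Linf_scaleR[of x "-1"] by simp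

lemma L2_diff: "x \<in> L2 \<Longrightarrow> y \<in> L2 \<Longrightarrow> x - y \<in> L2"
  using L2_add[OF _ L2_uminus, of x y] by simp

lemma Linf_diff: "x \<in> Linf \<Longrightarrow> y \<in> Linf \<Longrightarrow> x - y \<in> Linf"
  using Linf_add[OF _ Linf_uminus, of x y] by simp

lemma sum_norm_le:
  assumes "u \<in> L2" "v \<in> Linf"
  shows "sum_norm (u + v) \<le> L2_norm u + Linf_norm v"
  unfolding sum_norm_def
proof (rule cInf_lower)
  show "L2_norm u + Linf_norm v
      \<in> {L2_norm u' + Linf_norm v' | u' v'. u + v = u' + v' \<and> u' \<in> L2 \<and> v' \<in> Linf}"
    using assms by blast
  show "bdd_below {L2_norm u' + Linf_norm v' | u' v'. u + v = u' + v' \<and> u' \<in> L2 \<and> v' \<in> Linf}"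
    by (rule bdd_belowI[of _ 0]) auto
qed

lemma sum_norm_ge:
  assumes "x \<in> L2_sum_Linf"
    and "\<And>u v. x = u + v \<Longrightarrow> u \<in> L2 \<Longrightarrow> v \<in> Linf \<Longrightarrow> c \<le> L2_norm u + Linf_norm v"
  shows "c \<le> sum_norm x"
  unfolding sum_norm_def by (rule cInf_greatest) (use assms in \<open>auto simp: L2_sum_Linf_def\<close>)

lemma sum_norm_obtain:
  assumes "x \<in> L2_sum_Linf" and "sum_norm x < c"
  obtains u v where "u \<in> L2" "v \<in> Linf" "x = u + v" "L2_norm u + Linf_norm v < c"
  using sum_norm_ge[OF assms(1), of c] assms(2) by (meson not_le)

lemma L2_sum_Linf_zero: "0 \<in> L2_sum_Linf"
  unfolding L2_sum_Linf_def using L2_zero Linf_zero by (metis (mono_tags, lifting) add_0 mem_Collect_eq)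

lemma sum_norm_nonneg: "x \<in> L2_sum_Linf \<Longrightarrow> 0 \<le> sum_norm x"
  by (rule sum_norm_ge) auto

lemma sum_norm_zero [simp]: "sum_norm 0 = 0"
proof (rule antisym)
  show "sum_norm 0 \<le> 0"
    using sum_norm_le[of 0 0] by simp
  show "0 \<le> sum_norm 0"
    by (rule sum_norm_nonneg[OF L2_sum_Linf_zero])
qed

lemma sum_norm_triangle:
  assumes x: "x \<in> L2_sum_Linf"
    and y: "y \<in> L2_sum_Linf"
  shows "sum_norm (x + y) \<le> sum_norm x + sum_norm y"
proof (rule field_le_epsilon)
  fix e :: real
  assume "0 < e"
  then have e: "sum_norm x < sum_norm x + e / 2" "sum_norm y < sum_norm y + e / 2"
    by simp_all
  obtain u v where uv: "u \<in> L2" "v \<in> Linf" "x = u + v" "L2_norm u + Linf_norm v < sum_norm x + e / 2"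
    using sum_norm_obtain[OF x e(1)] by metis
  obtain u' v' where uv': "u' \<in> L2" "v' \<in> Linf" "y = u' + v'"
      "L2_norm u' + Linf_norm v' < sum_norm y + e / 2"
    using sum_norm_obtain[OF y e(2)] by metis
  have "sum_norm (x + y) = sum_norm ((u + u') + (v + v'))"
    using uv uv' by (simp add: algebra_simps)
  also have "\<dots> \<le> L2_norm (u + u') + Linf_norm (v + v')"
    using uv uv' by (intro sum_norm_le L2_add Linf_add)
  also have "\<dots> \<le> (L2_norm u + L2_norm u') + (Linf_norm v + Linf_norm v')"
    using uv uv' by (intro add_mono L2_norm_triangle Linf_norm_triangle)
  finally show "sum_norm (x + y) \<le> sum_norm x + sum_norm y + e"
    using uv(4) uv'(4) by simp
qed

lemma L2_sum_Linf_add: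
  assumes "x \<in> L2_sum_Linf" "y \<in> L2_sum_Linf"
  shows "x + y \<in> L2_sum_Linf"
proof -
  obtain u v u' v' where "x = u + v" "u \<in> L2" "v \<in> Linf" "y = u' + v'" "u' \<in> L2" "v' \<in> Linf"
    using assms unfolding L2_sum_Linf_def by blast
  then have "x + y = (u + u') + (v + v')" "u + u' \<in> L2" "v + v' \<in> Linf"
    by (simp_all add: algebra_simps L2_add Linf_add)
  then show ?thesis unfolding L2_sum_Linf_def by blast
qed

lemma L2_sum_Linf_diff:
  assumes "x \<in> L2_sum_Linf" "y \<in> L2_sum_Linf"
  shows "x - y \<in> L2_sum_Linf"
proof -
  obtain u v u' v' where "x = u + v" "u \<in> L2" "v \<in> Linf" "y = u' + v'" "u' \<in> L2" "v' \<in> Linf"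
    using assms unfolding L2_sum_Linf_def by blast
  then have "x - y = (u - u') + (v - v')" "u - u' \<in> L2" "v - v' \<in> Linf"
    by (simp_all add: algebra_simps L2_diff Linf_diff)
  then show ?thesis unfolding L2_sum_Linf_def by blast
qed

lemma L2_sum_Linf_scaleR:
  assumes "x \<in> L2_sum_Linf"
  shows "c *\<^sub>R x \<in> L2_sum_Linf"
proof -
  obtain u v where "u \<in> L2" "v \<in> Linf" "x = u + v"
    using assms unfolding L2_sum_Linf_def by blast
  then have "c *\<^sub>R x = c *\<^sub>R u + c *\<^sub>R v" "c *\<^sub>R u \<in> L2" "c *\<^sub>R v \<in> Linf"
    by (simp_all add: scaleR_add_right L2_scaleR Linf_scaleR)
  then show ?thesis unfolding L2_sum_Linf_def by blast
qed

lemma sum_norm_scaleR: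
  assumes "x \<in> L2_sum_Linf"
  shows "sum_norm (c *\<^sub>R x) = \<bar>c\<bar> * sum_norm x"
proof (cases "c = 0")
  case False
  have le: "sum_norm (d *\<^sub>R y) \<le> \<bar>d\<bar> * sum_norm y"
    if y: "y \<in> L2_sum_Linf" and "d \<noteq> 0" for d y
  proof -
    have "sum_norm (d *\<^sub>R y) / \<bar>d\<bar> \<le> sum_norm y"
    proof (rule sum_norm_ge[OF y])
      fix u v
      assume "y = u + v" "u \<in> L2" "v \<in> Linf"
      then have "sum_norm (d *\<^sub>R y) \<le> L2_norm (d *\<^sub>R u) + Linf_norm (d *\<^sub>R v)"
        by (simp add: scaleR_add_right sum_norm_le L2_scaleR Linf_scaleR)
      then show "sum_norm (d *\<^sub>R y) / \<bar>d\<bar> \<le> L2_norm u + Linf_norm v"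
        using \<open>d \<noteq> 0\<close> by (simp add: L2_norm_scaleR Linf_norm_scaleR field_simps)
    qed
    then show ?thesis
      using \<open>d \<noteq> 0\<close> by (simp add: field_simps)
  qed
  have "sum_norm x \<le> \<bar>inverse c\<bar> * sum_norm (c *\<^sub>R x)"
    using le[OF L2_sum_Linf_scaleR[OF assms, of c], of "inverse c"] False by simp
  then have "\<bar>c\<bar> * sum_norm x \<le> sum_norm (c *\<^sub>R x)"
    using False by (simp add: field_simps)
  with le[OF assms False] show ?thesis by simp
qed simp

lift_definition excess :: "real \<Rightarrow> L0 \<Rightarrow> L0" is "\<lambda>d f t. max 0 (\<bar>f t\<bar> - d)"
  by (auto elim: eventually_mono)

lemma excess_eq_0: "excess d x = 0 \<Longrightarrow> abs_esssup x \<le> ereal d"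
  by transfer (auto intro!: esssup_I elim: eventually_mono)

lemma AE_abs_le: "abs_esssup (abs_L0 f) \<le> ereal d \<Longrightarrow> f \<in> borel_measurable half_line \<Longrightarrow>
    AE t in half_line. \<bar>f t\<bar> \<le> d"
proof -
  assume "abs_esssup (abs_L0 f) \<le> ereal d" "f \<in> borel_measurable half_line"
  then have le: "esssup half_line (\<lambda>t. ereal \<bar>f t\<bar>) \<le> ereal d"
    by (simp add: abs_esssup.abs_eq)
  show ?thesis
    using esssup_AE[of "\<lambda>t. ereal \<bar>f t\<bar>" half_line]
  proof eventually_elim
    case (elim t)
    from order_trans[OF this le] show ?case by simp
  qed
qed

lemma L0_cases:
  obtains f where "f \<in> borel_measurable half_line" "x = abs_L0 f"
proof -
  have "abs_L0 (rep_L0 x) = x" "rep_L0 x \<in> borel_measurable half_line"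
    using Quotient_abs_rep[OF Quotient_L0, of x] Quotient_rep_reflp[OF Quotient_L0, of x] by auto
  then show ?thesis using that by metis
qed

lemma excess_L2:
  assumes "u \<in> L2" "abs_esssup v \<le> ereal d"
  shows "excess d (u + v) \<in> L2" "L2_norm (excess d (u + v)) \<le> L2_norm u"
proof -
  obtain f where f [measurable]: "f \<in> borel_measurable half_line" and u: "u = abs_L0 f"
    by (rule L0_cases)
  obtain g where g [measurable]: "g \<in> borel_measurable half_line" and v: "v = abs_L0 g"
    by (rule L0_cases)
  let ?h = "\<lambda>t. max 0 (\<bar>f t + g t\<bar> - d)"
  have ex: "excess d (u + v) = abs_L0 ?h"
    by (simp add: u v plus_L0.abs_eq excess.abs_eq)
  have int: "integrable half_line (\<lambda>t. (f t)\<^sup>2)"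
    using assms(1) by (simp add: u L2_def sq_integrable.abs_eq)
  have "AE t in half_line. \<bar>g t\<bar> \<le> d"
    using assms(2) by (intro AE_abs_le) (simp_all add: v)
  then have le: "AE t in half_line. (?h t)\<^sup>2 \<le> (f t)\<^sup>2"
  proof eventually_elim
    case (elim t)
    then show ?case by (intro abs_le_square_iff[THEN iffD1]) simp
  qed
  have int': "integrable half_line (\<lambda>t. (?h t)\<^sup>2)"
    by (rule Bochner_Integration.integrable_bound[OF int]) (use le in simp_all)
  then show "excess d (u + v) \<in> L2"
    by (simp add: ex L2_def sq_integrable.abs_eq)
  have "(\<integral>t. (?h t)\<^sup>2 \<partial>half_line) \<le> (\<integral>t. (f t)\<^sup>2 \<partial>half_line)"
    by (rule integral_mono_AE[OF int' int le])
  then show "L2_norm (excess d (u + v)) \<le> L2_norm u"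
    unfolding ex unfolding u by (simp add: L2_norm.abs_eq)
qed

lemma sum_norm_eq_0:
  assumes x: "x \<in> L2_sum_Linf"
  shows "sum_norm x = 0 \<longleftrightarrow> x = 0"
proof
  assume 0: "sum_norm x = 0"
  have le: "x \<in> Linf \<and> Linf_norm x \<le> d" if "0 < d" for d
  proof -
    have small: "excess d x \<in> L2 \<and> L2_norm (excess d x) \<le> e" if "0 < e" for e
    proof -
      have "sum_norm x < min d e"
        using 0 \<open>0 < d\<close> \<open>0 < e\<close> by simp
      then obtain u v where uv: "u \<in> L2" "v \<in> Linf" "x = u + v" "L2_norm u + Linf_norm v < min d e"
        using sum_norm_obtain[OF x] by metis
      moreover have "L2_norm u \<le> e" "Linf_norm v \<le> d"
        using uv(4) L2_norm_nonneg[of u] Linf_norm_nonneg[of v] by linarith+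
      ultimately show ?thesis
        using excess_L2[of u v d] by (auto simp: abs_esssup_eq)
    qed
    have "L2_norm (excess d x) \<le> 0"
      by (rule field_le_epsilon) (use small in simp)
    then have "excess d x = 0"
      using small[of 1] L2_norm_eq_0[of "excess d x"] L2_norm_nonneg[of "excess d x"] by simp
    then show ?thesis
      using excess_eq_0 by (simp add: Linf_norm_le_iff)
  qed
  have "Linf_norm x \<le> 0"
    by (rule field_le_epsilon) (use le in simp)
  then show "x = 0"
    using le[of 1] Linf_norm_eq_0[of x] Linf_norm_nonneg[of x] by simp
qed simp

instantiation L2_plus_Linf :: real_vector
begin

lift_definition zero_L2_plus_Linf :: L2_plus_Linf is 0
  by (rule L2_sum_Linf_zero)

lift_definition plus_L2_plus_Linf :: "L2_plus_Linf \<Rightarrow> L2_plus_Linf \<Rightarrow> L2_plus_Linf" is "(+)"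
  by (rule L2_sum_Linf_add)

lift_definition scaleR_L2_plus_Linf :: "real \<Rightarrow> L2_plus_Linf \<Rightarrow> L2_plus_Linf" is "(*\<^sub>R)"
  by (rule L2_sum_Linf_scaleR)

lift_definition uminus_L2_plus_Linf :: "L2_plus_Linf \<Rightarrow> L2_plus_Linf" is uminus
  using L2_sum_Linf_scaleR[where c = "-1"] by simp

lift_definition minus_L2_plus_Linf :: "L2_plus_Linf \<Rightarrow> L2_plus_Linf \<Rightarrow> L2_plus_Linf" is "(-)"
  by (rule L2_sum_Linf_diff)

instance
proof
  fix x y z :: L2_plus_Linf and a b :: real
  show "x + y + z = x + (y + z)" "x + y = y + x" "0 + x = x" "- x + x = 0" "x - y = x + - y"
    by (transfer; simp)+
  show "a *\<^sub>R (x + y) = a *\<^sub>R x + a *\<^sub>R y" "(a + b) *\<^sub>R x = a *\<^sub>R x + b *\<^sub>R x"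
    "a *\<^sub>R b *\<^sub>R x = (a * b) *\<^sub>R x" "1 *\<^sub>R x = x"
    by (transfer; simp add: scaleR_add_right scaleR_add_left)+
qed

end

instantiation L2_plus_Linf :: real_normed_vector
begin

lift_definition norm_L2_plus_Linf :: "L2_plus_Linf \<Rightarrow> real" is sum_norm .

definition dist_L2_plus_Linf :: "L2_plus_Linf \<Rightarrow> L2_plus_Linf \<Rightarrow> real"
  where "dist_L2_plus_Linf x y = norm (x - y)"

definition sgn_L2_plus_Linf :: "L2_plus_Linf \<Rightarrow> L2_plus_Linf"
  where "sgn_L2_plus_Linf x = x /\<^sub>R norm x"

definition uniformity_L2_plus_Linf :: "(L2_plus_Linf \<times> L2_plus_Linf) filter"
  where "uniformity_L2_plus_Linf = (INF e\<in>{0<..}. principal {(x, y). dist x y < e})"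

definition open_L2_plus_Linf :: "L2_plus_Linf set \<Rightarrow> bool"
  where "open_L2_plus_Linf U = (\<forall>x\<in>U. \<forall>\<^sub>F (x', y) in uniformity. x' = x \<longrightarrow> y \<in> U)"

instance
proof
  fix x y :: L2_plus_Linf and a :: real
  show "norm x = 0 \<longleftrightarrow> x = 0" by transfer (rule sum_norm_eq_0)
  show "norm (x + y) \<le> norm x + norm y" by transfer (rule sum_norm_triangle)
  show "norm (a *\<^sub>R x) = \<bar>a\<bar> * norm x" by transfer (rule sum_norm_scaleR)
qed (simp_all only: dist_L2_plus_Linf_def sgn_L2_plus_Linf_def uniformity_L2_plus_Linf_def
      open_L2_plus_Linf_def)

end

instantiation L2_cap_Linf :: real_vector
begin

lift_definition zero_L2_cap_Linf :: L2_cap_Linf is 0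
  by simp

lift_definition plus_L2_cap_Linf :: "L2_cap_Linf \<Rightarrow> L2_cap_Linf \<Rightarrow> L2_cap_Linf" is "(+)"
  by (simp add: L2_add Linf_add)

lift_definition scaleR_L2_cap_Linf :: "real \<Rightarrow> L2_cap_Linf \<Rightarrow> L2_cap_Linf" is "(*\<^sub>R)"
  by (simp add: L2_scaleR Linf_scaleR)

lift_definition uminus_L2_cap_Linf :: "L2_cap_Linf \<Rightarrow> L2_cap_Linf" is uminus
  by (simp add: L2_uminus Linf_uminus)

lift_definition minus_L2_cap_Linf :: "L2_cap_Linf \<Rightarrow> L2_cap_Linf \<Rightarrow> L2_cap_Linf" is "(-)"
  by (simp add: L2_diff Linf_diff)

instance
proof
  fix x y z :: L2_cap_Linf and a b :: real
  show "x + y + z = x + (y + z)" "x + y = y + x" "0 + x = x" "- x + x = 0" "x - y = x + - y"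
    by (transfer; simp)+
  show "a *\<^sub>R (x + y) = a *\<^sub>R x + a *\<^sub>R y" "(a + b) *\<^sub>R x = a *\<^sub>R x + b *\<^sub>R x"
    "a *\<^sub>R b *\<^sub>R x = (a * b) *\<^sub>R x" "1 *\<^sub>R x = x"
    by (transfer; simp add: scaleR_add_right scaleR_add_left)+
qed

end

instantiation L2_cap_Linf :: real_normed_vector
begin

lift_definition norm_L2_cap_Linf :: "L2_cap_Linf \<Rightarrow> real" is cap_norm .

definition dist_L2_cap_Linf :: "L2_cap_Linf \<Rightarrow> L2_cap_Linf \<Rightarrow> real"
  where "dist_L2_cap_Linf x y = norm (x - y)"

definition sgn_L2_cap_Linf :: "L2_cap_Linf \<Rightarrow> L2_cap_Linf"
  where "sgn_L2_cap_Linf x = x /\<^sub>R norm x"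

definition uniformity_L2_cap_Linf :: "(L2_cap_Linf \<times> L2_cap_Linf) filter"
  where "uniformity_L2_cap_Linf = (INF e\<in>{0<..}. principal {(x, y). dist x y < e})"

definition open_L2_cap_Linf :: "L2_cap_Linf set \<Rightarrow> bool"
  where "open_L2_cap_Linf U = (\<forall>x\<in>U. \<forall>\<^sub>F (x', y) in uniformity. x' = x \<longrightarrow> y \<in> U)"

instance
proof
  fix x y :: L2_cap_Linf and a :: real
  show "norm x = 0 \<longleftrightarrow> x = 0"
  proof transfer
    fix x
    assume "x \<in> L2 \<inter> Linf"
    then show "cap_norm x = 0 \<longleftrightarrow> x = 0"
      using L2_norm_eq_0[of x] L2_norm_nonneg[of x] Linf_norm_nonneg[of x]
      unfolding cap_norm_def by (metis Int_iff L2_norm_zero Linf_norm_zero antisym max.cobounded1 max.idem)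
  qed
  show "norm (x + y) \<le> norm x + norm y"
  proof transfer
    fix x y
    assume "x \<in> L2 \<inter> Linf" "y \<in> L2 \<inter> Linf"
    then show "cap_norm (x + y) \<le> cap_norm x + cap_norm y"
      using L2_norm_triangle[of x y] Linf_norm_triangle[of x y] by (auto simp: cap_norm_def)
  qed
  show "norm (a *\<^sub>R x) = \<bar>a\<bar> * norm x"
    by transfer (simp add: cap_norm_def L2_norm_scaleR Linf_norm_scaleR max_mult_distrib_left)
qed (simp_all only: dist_L2_cap_Linf_def sgn_L2_cap_Linf_def uniformity_L2_cap_Linf_def
      open_L2_cap_Linf_def)

end

section \<open>Completeness\<close>

lemma convergent_if_summable_convergent:
  fixes X :: "nat \<Rightarrow> 'a :: real_normed_vector"
  assumes complete: "\<And>Y :: nat \<Rightarrow> 'a. summable (\<lambda>n. norm (Y n)) \<Longrightarrow> convergent (\<lambda>n. \<Sum>i<n. Y i)"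
    and X: "Cauchy X"
  shows "convergent X"
proof -
  have "\<exists>M. \<forall>m\<ge>M. \<forall>n\<ge>M. norm (X m - X n) < (1 / 2) ^ k" for k :: nat
    using CauchyD[OF X, of "(1 / 2) ^ k"] by simp
  then obtain M where M: "\<And>k m n. M k \<le> m \<Longrightarrow> M k \<le> n \<Longrightarrow> norm (X m - X n) < (1 / 2) ^ k"
    by metis
  define r where "r k = (\<Sum>i\<le>k. M i) + k" for k
  have r: "strict_mono r"
    unfolding strict_mono_Suc_iff by (simp add: r_def)
  have M_r: "M k \<le> r k" for k
    unfolding r_def by (simp add: member_le_sum trans_le_add1)
  define Y where "Y k = X (r (Suc k)) - X (r k)" for k
  have Y_le: "norm (Y k) \<le> (1 / 2) ^ k" for k
  proof -
    have "r k \<le> r (Suc k)"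
      using strict_monoD[OF r lessI, of k] by (rule less_imp_le)
    then show ?thesis
      unfolding Y_def using M[OF order_trans[OF M_r] M_r, of k "r (Suc k)"] by simp
  qed
  have geometric: "summable (\<lambda>k. (1 / 2 :: real) ^ k)"
    by (simp add: summable_geometric)
  have "summable (\<lambda>k. norm (Y k))"
    by (rule summable_comparison_test'[OF geometric, of 0]) (simp add: Y_le)
  then obtain l where l: "(\<lambda>n. \<Sum>i<n. Y i) \<longlonglongrightarrow> l"
    using complete unfolding convergent_def by blast
  have "(\<Sum>i<n. Y i) = X (r n) - X (r 0)" for n
    unfolding Y_def by (rule sum_lessThan_telescope)
  then have "(\<lambda>n. X (r n)) \<longlonglongrightarrow> l + X (r 0)"
    using tendsto_add[OF l tendsto_const[of "X (r 0)"]] by simp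
  then have "X \<longlonglongrightarrow> l + X (r 0)"
    using Cauchy_converges_subseq[OF X r] by (simp add: o_def)
  then show ?thesis
    by (rule convergentI)
qed

lemma sum_abs_L0:
  fixes n :: nat
  assumes "\<And>n. f n \<in> borel_measurable half_line"
  shows "(\<Sum>i<n. abs_L0 (f i)) = abs_L0 (\<lambda>t. \<Sum>i<n. f i t)"
proof (induction n)
  case 0
  show ?case by (simp add: zero_L0_def)
next
  case (Suc n)
  then show ?case using assms by (simp add: plus_L0.abs_eq)
qed

lemma partial_sum_bound:
  fixes f :: "nat \<Rightarrow> real"
  assumes "\<And>N. (\<Sum>i<N. \<bar>f (i + n)\<bar>) \<le> B"
  shows "summable f" "\<bar>(\<Sum>i<n. f i) - suminf f\<bar> \<le> B"
proof -
  have abs: "summable (\<lambda>i. \<bar>f (i + n)\<bar>)"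
    by (rule bounded_imp_summable[where B = B])
      (use assms[of "Suc _"] in \<open>simp_all add: lessThan_Suc_atMost\<close>)
  then have sum: "summable (\<lambda>i. f (i + n))"
    by (rule summable_rabs_cancel)
  then show f: "summable f"
    by (simp add: summable_iff_shift)
  have "suminf f - (\<Sum>i<n. f i) = (\<Sum>i. f (i + n))"
    by (rule suminf_minus_initial_segment[OF f, symmetric])
  then have "\<bar>(\<Sum>i<n. f i) - suminf f\<bar> = \<bar>\<Sum>i. f (i + n)\<bar>"
    by simp
  also have "\<dots> \<le> (\<Sum>i. \<bar>f (i + n)\<bar>)"
    by (rule summable_rabs[OF abs])
  also have "\<dots> \<le> B"
    by (rule suminf_le_const[OF abs assms])
  finally show "\<bar>(\<Sum>i<n. f i) - suminf f\<bar> \<le> B" .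
qed

lemma tail_tendsto_0:
  fixes a :: "nat \<Rightarrow> real"
  assumes "summable a"
  shows "(\<lambda>n. \<Sum>i. a (i + n)) \<longlonglongrightarrow> 0"
proof -
  have "(\<lambda>n. suminf a - (\<Sum>i<n. a i)) \<longlonglongrightarrow> suminf a - suminf a"
    by (intro tendsto_diff tendsto_const summable_LIMSEQ assms)
  then show ?thesis
    by (simp add: suminf_minus_initial_segment[OF assms])
qed

lemma Linf_series:
  assumes x: "\<And>n. x n \<in> Linf" and sum: "summable (\<lambda>n. Linf_norm (x n))"
  shows "\<exists>s\<in>Linf. (\<lambda>n. Linf_norm ((\<Sum>i<n. x i) - s)) \<longlonglongrightarrow> 0"
proof -
  define a where "a = (\<lambda>n. Linf_norm (x n))"
  have a: "summable a" using sum by (simp add: a_def)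
  have "\<forall>n. \<exists>f. f \<in> borel_measurable half_line \<and> x n = abs_L0 f"
    by (metis L0_cases)
  then obtain f where f [measurable]: "\<And>n. f n \<in> borel_measurable half_line"
      and xf: "\<And>n. x n = abs_L0 (f n)"
    by metis
  have le: "AE t in half_line. \<forall>n. \<bar>f n t\<bar> \<le> a n"
    unfolding AE_all_countable
    by (intro allI AE_abs_le) (simp_all add: xf[symmetric] abs_esssup_eq x a_def)
  define s where "s = (\<lambda>t. \<Sum>i. f i t)"
  have s [measurable]: "s \<in> borel_measurable half_line"
    unfolding s_def by measurable
  have bound: "abs_esssup ((\<Sum>i<n. x i) - abs_L0 s) \<le> ereal (\<Sum>i. a (i + n))" for n
  proof -
    have "AE t in half_line. \<bar>(\<Sum>i<n. f i t) - s t\<bar> \<le> (\<Sum>i. a (i + n))"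
      using le
    proof eventually_elim
      case (elim t)
      have "(\<Sum>i<N. \<bar>f (i + n) t\<bar>) \<le> (\<Sum>i. a (i + n))" for N
      proof -
        have "(\<Sum>i<N. \<bar>f (i + n) t\<bar>) \<le> (\<Sum>i<N. a (i + n))"
          using elim by (intro sum_mono) simp
        also have "\<dots> \<le> (\<Sum>i. a (i + n))"
          by (intro sum_le_suminf summable_ignore_initial_segment a) (simp_all add: a_def)
        finally show ?thesis .
      qed
      then show ?case
        unfolding s_def by (rule partial_sum_bound(2))
    qed
    then have "esssup half_line (\<lambda>t. ereal \<bar>(\<Sum>i<n. f i t) - s t\<bar>) \<le> ereal (\<Sum>i. a (i + n))"
      by (intro esssup_I) auto
    then show ?thesis
      by (simp add: xf sum_abs_L0 minus_L0.abs_eq abs_esssup.abs_eq)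
  qed
  have "(\<lambda>n. Linf_norm ((\<Sum>i<n. x i) - abs_L0 s)) \<longlonglongrightarrow> 0"
    by (rule tendsto_sandwich[OF _ _ tendsto_const tail_tendsto_0[OF a]])
      (simp_all add: bound Linf_norm_le_iff[THEN iffD2, THEN conjunct2])
  moreover have "abs_L0 s \<in> Linf"
    using bound[of 0] Linf_norm_le_iff[of "- abs_L0 s"] Linf_uminus[of "- abs_L0 s"] by auto
  ultimately show ?thesis by blast
qed

lemma L2_series:
  assumes x: "\<And>n. x n \<in> L2" and sum: "summable (\<lambda>n. L2_norm (x n))"
  shows "\<exists>s\<in>L2. (\<lambda>n. L2_norm ((\<Sum>i<n. x i) - s)) \<longlonglongrightarrow> 0"
proof -
  define a where "a = (\<lambda>n. L2_norm (x n))"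
  have a: "summable a" and a_nonneg: "0 \<le> a n" for n
    using sum by (simp_all add: a_def)
  have "\<forall>n. \<exists>f. f \<in> borel_measurable half_line \<and> x n = abs_L0 f"
    by (metis L0_cases)
  then obtain f where f [measurable]: "\<And>n. f n \<in> borel_measurable half_line"
      and xf: "\<And>n. x n = abs_L0 (f n)"
    by metis
  have int: "integrable half_line (\<lambda>t. (f n t)\<^sup>2)" for n
    using x[of n] by (simp add: xf L2_def sq_integrable.abs_eq)
  have norm: "sqrt (\<integral>t. (f n t)\<^sup>2 \<partial>half_line) = a n" for n
    by (simp add: a_def xf L2_norm.abs_eq)
  define G where "G n N t = (\<Sum>i<N. \<bar>f (i + n) t\<bar>)" for n N t
  have G [measurable]: "G n N \<in> borel_measurable half_line" for n N
    unfolding G_def by measurable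
  have G_nonneg: "0 \<le> G n N t" for n N t
    unfolding G_def by (simp add: sum_nonneg)
  have G_int: "integrable half_line (\<lambda>t. (G n N t)\<^sup>2) \<and>
      sqrt (\<integral>t. (G n N t)\<^sup>2 \<partial>half_line) \<le> (\<Sum>i<N. a (i + n))" for n N
  proof (induction N)
    case 0
    show ?case by (simp add: G_def)
  next
    case (Suc N)
    have eq: "G n (Suc N) t = G n N t + \<bar>f (N + n) t\<bar>" for t
      by (simp add: G_def)
    show ?case
      using Suc sq_integral_add[of "G n N" half_line "\<lambda>t. \<bar>f (N + n) t\<bar>"] int[of "N + n"]
      by (simp add: eq norm)
  qed
  define T where "T n = (\<Sum>i. a (i + n))" for n
  have T_nonneg: "0 \<le> T n" for n
    unfolding T_def by (intro suminf_nonneg summable_ignore_initial_segment a a_nonneg)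
  define H where "H n t = (SUP N. ennreal ((G n N t)\<^sup>2))" for n t
  have H [measurable]: "H n \<in> borel_measurable half_line" for n
    unfolding H_def by measurable
  have H_int: "(\<integral>\<^sup>+t. H n t \<partial>half_line) \<le> ennreal ((T n)\<^sup>2)" for n
  proof -
    have "(\<integral>\<^sup>+t. H n t \<partial>half_line) = (SUP N. \<integral>\<^sup>+t. ennreal ((G n N t)\<^sup>2) \<partial>half_line)"
      unfolding H_def
    proof (rule nn_integral_monotone_convergence_SUP)
      have "G n N t \<le> G n (Suc N) t" for N t
        by (simp add: G_def)
      then show "incseq (\<lambda>N t. ennreal ((G n N t)\<^sup>2))"
        by (intro incseq_SucI le_funI ennreal_leI power_mono G_nonneg)
    qed measurable
    also have "\<dots> \<le> ennreal ((T n)\<^sup>2)"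
    proof (rule SUP_least)
      fix N
      have "sqrt (\<integral>t. (G n N t)\<^sup>2 \<partial>half_line) \<le> (\<Sum>i<N. a (i + n))"
        using G_int by blast
      also have "\<dots> \<le> T n"
        unfolding T_def
        by (intro sum_le_suminf summable_ignore_initial_segment a) (simp_all add: a_nonneg)
      finally have "(\<integral>t. (G n N t)\<^sup>2 \<partial>half_line) \<le> (T n)\<^sup>2"
        by (rule sqrt_le_D)
      then show "(\<integral>\<^sup>+t. ennreal ((G n N t)\<^sup>2) \<partial>half_line) \<le> ennreal ((T n)\<^sup>2)"
        using G_int[of n N] by (simp add: nn_integral_eq_integral ennreal_leI)
    qed
    finally show ?thesis .
  qed
  define s where "s = (\<lambda>t. \<Sum>i. f i t)"
  have s [measurable]: "s \<in> borel_measurable half_line"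
    unfolding s_def by measurable
  have bound: "(\<lambda>t. (\<Sum>i<n. f i t) - s t) \<in> borel_measurable half_line \<and>
      integrable half_line (\<lambda>t. ((\<Sum>i<n. f i t) - s t)\<^sup>2) \<and>
      sqrt (\<integral>t. ((\<Sum>i<n. f i t) - s t)\<^sup>2 \<partial>half_line) \<le> T n" for n
  proof -
    have "(\<integral>\<^sup>+t. H n t \<partial>half_line) \<noteq> \<infinity>"
      using H_int[of n] by (auto simp: top_unique)
    then have "AE t in half_line. H n t \<noteq> \<infinity>"
      by (intro nn_integral_PInf_AE) simp_all
    then have "AE t in half_line. ennreal (((\<Sum>i<n. f i t) - s t)\<^sup>2) \<le> H n t"
    proof eventually_elim
      case (elim t)
      then obtain h where h: "0 \<le> h" "H n t = ennreal h"
        by (cases "H n t") auto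
      have "ennreal ((G n N t)\<^sup>2) \<le> ennreal h" for N
        unfolding h(2)[symmetric] H_def by (rule SUP_upper) simp
      then have "(\<Sum>i<N. \<bar>f (i + n) t\<bar>) \<le> sqrt h" for N
        using h(1) unfolding G_def by (intro real_le_rsqrt) simp
      then have "\<bar>(\<Sum>i<n. f i t) - s t\<bar> \<le> sqrt h"
        unfolding s_def by (rule partial_sum_bound(2))
      then have "((\<Sum>i<n. f i t) - s t)\<^sup>2 \<le> h"
        using h(1) by (simp add: sqrt_le_D real_sqrt_abs[symmetric] del: real_sqrt_abs)
      then show ?case
        using h by (simp add: ennreal_leI)
    qed
    then have "(\<integral>\<^sup>+t. ennreal (((\<Sum>i<n. f i t) - s t)\<^sup>2) \<partial>half_line) \<le> (\<integral>\<^sup>+t. H n t \<partial>half_line)"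
      by (rule nn_integral_mono_AE)
    also note H_int
    finally have le: "(\<integral>\<^sup>+t. ennreal (((\<Sum>i<n. f i t) - s t)\<^sup>2) \<partial>half_line) \<le> ennreal ((T n)\<^sup>2)" .
    then have *: "integrable half_line (\<lambda>t. ((\<Sum>i<n. f i t) - s t)\<^sup>2)"
      by (intro integrableI_nonneg) (auto simp: le_less_trans[OF le])
    then have "(\<integral>t. ((\<Sum>i<n. f i t) - s t)\<^sup>2 \<partial>half_line) \<le> (T n)\<^sup>2"
      using le by (simp add: nn_integral_eq_integral)
    then show ?thesis
      using * T_nonneg by (simp add: real_le_lsqrt)
  qed
  have "(\<lambda>n. L2_norm ((\<Sum>i<n. x i) - abs_L0 s)) \<longlonglongrightarrow> 0"
  proof (rule tendsto_sandwich[OF _ _ tendsto_const tail_tendsto_0[OF a]])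
    show "\<forall>\<^sub>F n in sequentially. L2_norm ((\<Sum>i<n. x i) - abs_L0 s) \<le> (\<Sum>i. a (i + n))"
      using bound by (simp add: xf sum_abs_L0 minus_L0.abs_eq L2_norm.abs_eq T_def)
  qed simp
  moreover have "abs_L0 s \<in> L2"
    using bound[of 0] by (simp add: L2_def sq_integrable.abs_eq)
  ultimately show ?thesis by blast
qed

lemma Rep_L2_cap_Linf_sum: "Rep_L2_cap_Linf (\<Sum>i<n. Y i) = (\<Sum>i<n. Rep_L2_cap_Linf (Y i))"
  for n :: nat
  by (induction n) (simp_all add: zero_L2_cap_Linf.rep_eq plus_L2_cap_Linf.rep_eq)

lemma Rep_L2_plus_Linf_sum: "Rep_L2_plus_Linf (\<Sum>i<n. Y i) = (\<Sum>i<n. Rep_L2_plus_Linf (Y i))"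
  for n :: nat
  by (induction n) (simp_all add: zero_L2_plus_Linf.rep_eq plus_L2_plus_Linf.rep_eq)

lemma sum_in_L2: "(\<And>i. x i \<in> L2) \<Longrightarrow> (\<Sum>i<n. x i) \<in> L2" for n :: nat
  by (induction n) (simp_all add: L2_add)

lemma sum_in_Linf: "(\<And>i. x i \<in> Linf) \<Longrightarrow> (\<Sum>i<n. x i) \<in> Linf" for n :: nat
  by (induction n) (simp_all add: Linf_add)

lemma L2_sum_LinfI: "u \<in> L2 \<Longrightarrow> v \<in> Linf \<Longrightarrow> u + v \<in> L2_sum_Linf"
  unfolding L2_sum_Linf_def by blast

lemma L2_norm_uminus: "L2_norm (- x) = L2_norm x"
  using L2_norm_scaleR[of "-1" x] by simp

instance L2_cap_Linf :: banach
proof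
  fix X :: "nat \<Rightarrow> L2_cap_Linf"
  assume "Cauchy X"
  then show "convergent X"
  proof (rule convergent_if_summable_convergent[rotated])
    fix Y :: "nat \<Rightarrow> L2_cap_Linf"
    assume sum: "summable (\<lambda>n. norm (Y n))"
    define y where "y n = Rep_L2_cap_Linf (Y n)" for n
    have y: "y n \<in> L2" "y n \<in> Linf" for n
      using Rep_L2_cap_Linf[of "Y n"] by (simp_all add: y_def)
    have norm: "norm (Y n) = max (L2_norm (y n)) (Linf_norm (y n))" for n
      by (simp add: norm_L2_cap_Linf.rep_eq cap_norm_def y_def)
    have "summable (\<lambda>n. L2_norm (y n))" "summable (\<lambda>n. Linf_norm (y n))"
      by (rule summable_comparison_test'[OF sum, of 0]; simp add: norm)+
    then obtain s s' where s: "s \<in> L2" "(\<lambda>n. L2_norm ((\<Sum>i<n. y i) - s)) \<longlonglongrightarrow> 0"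
      and s': "s' \<in> Linf" "(\<lambda>n. Linf_norm ((\<Sum>i<n. y i) - s')) \<longlonglongrightarrow> 0"
      using L2_series[of y] Linf_series[of y] y by blast
    have mem: "s - s' \<in> L2_sum_Linf"
      using L2_sum_LinfI[OF s(1) Linf_uminus[OF s'(1)]] by simp
    have "sum_norm (s - s') \<le> L2_norm ((\<Sum>i<n. y i) - s) + Linf_norm ((\<Sum>i<n. y i) - s')" for n
    proof -
      have "sum_norm (- ((\<Sum>i<n. y i) - s) + ((\<Sum>i<n. y i) - s'))
          \<le> L2_norm (- ((\<Sum>i<n. y i) - s)) + Linf_norm ((\<Sum>i<n. y i) - s')"
        by (intro sum_norm_le L2_uminus L2_diff Linf_diff sum_in_L2 sum_in_Linf y s s')
      then show ?thesis
        unfolding L2_norm_uminus by simp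
    qed
    then have "sum_norm (s - s') \<le> 0"
      using tendsto_lowerbound[OF tendsto_add[OF s(2) s'(2)], of "sum_norm (s - s')"] by simp
    then have "s = s'"
      using sum_norm_eq_0[OF mem] sum_norm_nonneg[OF mem] by simp
    define S where "S = Abs_L2_cap_Linf s"
    have S: "Rep_L2_cap_Linf S = s"
      unfolding S_def using s s' \<open>s = s'\<close> by (simp add: Abs_L2_cap_Linf_inverse)
    have "(\<lambda>n. norm ((\<Sum>i<n. Y i) - S)) \<longlonglongrightarrow> max 0 0"
      unfolding norm_L2_cap_Linf.rep_eq minus_L2_cap_Linf.rep_eq Rep_L2_cap_Linf_sum S
        cap_norm_def y_def[symmetric]
      using s s' \<open>s = s'\<close> by (intro tendsto_max) simp_all
    then have "(\<lambda>n. \<Sum>i<n. Y i) \<longlonglongrightarrow> S"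
      by (simp add: tendsto_norm_zero_iff LIM_zero_iff)
    then show "convergent (\<lambda>n. \<Sum>i<n. Y i)"
      by (rule convergentI)
  qed
qed

instance L2_plus_Linf :: banach
proof
  fix X :: "nat \<Rightarrow> L2_plus_Linf"
  assume "Cauchy X"
  then show "convergent X"
  proof (rule convergent_if_summable_convergent[rotated])
    fix Y :: "nat \<Rightarrow> L2_plus_Linf"
    assume sum: "summable (\<lambda>n. norm (Y n))"
    define y where "y n = Rep_L2_plus_Linf (Y n)" for n
    have "\<exists>u v. u \<in> L2 \<and> v \<in> Linf \<and> y n = u + v \<and>
        L2_norm u + Linf_norm v < norm (Y n) + (1 / 2) ^ n" for n
      using sum_norm_obtain[of "y n" "norm (Y n) + (1 / 2) ^ n"] Rep_L2_plus_Linf[of "Y n"]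
      by (metis less_add_same_cancel1 norm_L2_plus_Linf.rep_eq y_def zero_less_divide_1_iff
          zero_less_numeral zero_less_power)
    then obtain u v where uv: "\<And>n. u n \<in> L2" "\<And>n. v n \<in> Linf" "\<And>n. y n = u n + v n"
        and le: "\<And>n. L2_norm (u n) + Linf_norm (v n) < norm (Y n) + (1 / 2) ^ n"
      by metis
    have sum': "summable (\<lambda>n. norm (Y n) + (1 / 2) ^ n)"
      by (intro summable_add sum) (simp add: summable_geometric)
    have "L2_norm (u n) \<le> norm (Y n) + (1 / 2) ^ n" "Linf_norm (v n) \<le> norm (Y n) + (1 / 2) ^ n" for n
      using le[of n] L2_norm_nonneg[of "u n"] Linf_norm_nonneg[of "v n"] by linarith+
    then have "summable (\<lambda>n. L2_norm (u n))" "summable (\<lambda>n. Linf_norm (v n))"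
      by (auto intro!: summable_comparison_test'[OF sum', of 0])
    then obtain s s' where s: "s \<in> L2" "(\<lambda>n. L2_norm ((\<Sum>i<n. u i) - s)) \<longlonglongrightarrow> 0"
      and s': "s' \<in> Linf" "(\<lambda>n. Linf_norm ((\<Sum>i<n. v i) - s')) \<longlonglongrightarrow> 0"
      using L2_series[of u] Linf_series[of v] uv by blast
    define S where "S = Abs_L2_plus_Linf (s + s')"
    have S: "Rep_L2_plus_Linf S = s + s'"
      unfolding S_def using L2_sum_LinfI[OF s(1) s'(1)] by (simp add: Abs_L2_plus_Linf_inverse)
    have bound: "norm ((\<Sum>i<n. Y i) - S)
        \<le> L2_norm ((\<Sum>i<n. u i) - s) + Linf_norm ((\<Sum>i<n. v i) - s')" for n
    proof -
      have "norm ((\<Sum>i<n. Y i) - S) = sum_norm (((\<Sum>i<n. u i) - s) + ((\<Sum>i<n. v i) - s'))"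
        unfolding norm_L2_plus_Linf.rep_eq minus_L2_plus_Linf.rep_eq Rep_L2_plus_Linf_sum S
          y_def[symmetric] uv(3) sum.distrib by (simp add: algebra_simps)
      also have "\<dots> \<le> L2_norm ((\<Sum>i<n. u i) - s) + Linf_norm ((\<Sum>i<n. v i) - s')"
        by (intro sum_norm_le L2_diff Linf_diff sum_in_L2 sum_in_Linf uv s s')
      finally show ?thesis .
    qed
    have "(\<lambda>n. L2_norm ((\<Sum>i<n. u i) - s) + Linf_norm ((\<Sum>i<n. v i) - s')) \<longlonglongrightarrow> 0"
      using tendsto_add[OF s(2) s'(2)] by simp
    then have "(\<lambda>n. norm ((\<Sum>i<n. Y i) - S)) \<longlonglongrightarrow> 0"
      by (rule tendsto_sandwich[OF _ _ tendsto_const, rotated 2]) (use bound in simp_all)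
    then have "(\<lambda>n. \<Sum>i<n. Y i) \<longlonglongrightarrow> S"
      by (simp add: tendsto_norm_zero_iff LIM_zero_iff)
    then show "convergent (\<lambda>n. \<Sum>i<n. Y i)"
      by (rule convergentI)
  qed
qed

end

(* Put step functions r_m = sqrt n * 1_{(m/n, (m+1)/n]}; they are orthonormal in L2. In
   L2 + L_infinity the n functions of the block m = kn, ..., kn + n - 1 satisfy an upper l2-estimate
   and are biorthogonal to functionals obeying Bessel's inequality. An isomorphism T therefore carries
   them to functions y_m = T r_m spanning a uniformly complemented copy of l2^n in
   L2 \<inter> L_infinity. Since l2^n is not uniformly complemented in L_infinity (a form of the little
   Grothendieck inequality, obtained here by truncating Rademacher sums), for a fixed large n the
   sum of the squared L2-norms of the y_m over each block is at least a constant times n. On the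
   other hand, in L2 + L_infinity signed sums of r_{kn+j} over k < N are bounded by sqrt n for every
   N, so averaging the squared L2-norm of their images over signs bounds the sum over k < N of the
   squared L2-norms of y_{kn+j} independently of N, a contradiction as N tends to infinity. *)

theory Submission
  imports Defs
begin

section \<open>Representatives of classes\<close>

lemma rep_L0_measurable [measurable, simp]: "rep_L0 x \<in> borel_measurable half_line"
  using Quotient_rep_reflp[OF Quotient_L0, of x] by auto

lemma abs_rep_L0 [simp]: "abs_L0 (rep_L0 x) = x"
  using Quotient_abs_rep[OF Quotient_L0] .

lemma AE_rep_abs_L0:
  assumes "f \<in> borel_measurable half_line"
  shows "AE t in half_line. rep_L0 (abs_L0 f) t = f t"
  using Quotient_rep_abs[OF Quotient_L0, of f] assms by auto

text \<open>Representatives are chosen class by class, so linearity of \<open>rep_L0\<close> holds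
  only outside a null set depending on the combination; finite sums keep the exceptional set
  null.\<close>

lemma AE_rep_L0_sum:
  assumes "finite I"
  shows "AE t in half_line. rep_L0 (\<Sum>i\<in>I. c i *\<^sub>R x i) t = (\<Sum>i\<in>I. c i * rep_L0 (x i) t)"
  using assms
proof (induction I)
  case empty
  show ?case
    using AE_rep_abs_L0[of "\<lambda>_. 0"] by (simp add: zero_L0_def)
next
  case (insert i I)
  let ?s = "\<Sum>i\<in>I. c i *\<^sub>R x i"
  have "c i *\<^sub>R x i + ?s = c i *\<^sub>R abs_L0 (rep_L0 (x i)) + abs_L0 (rep_L0 ?s)"
    by simp
  also have "\<dots> = abs_L0 (\<lambda>t. c i * rep_L0 (x i) t + rep_L0 ?s t)"
    by (subst scaleR_L0.abs_eq, simp, subst plus_L0.abs_eq) simp_all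
  finally have "AE t in half_line. rep_L0 (c i *\<^sub>R x i + ?s) t = c i * rep_L0 (x i) t + rep_L0 ?s t"
    using AE_rep_abs_L0[of "\<lambda>t. c i * rep_L0 (x i) t + rep_L0 ?s t"] by simp
  with insert.IH show ?case
    using insert.hyps by (auto elim: eventually_elim2)
qed

lemma L2_iff_rep: "x \<in> L2 \<longleftrightarrow> integrable half_line (\<lambda>t. (rep_L0 x t)\<^sup>2)"
  using sq_integrable.abs_eq[of "rep_L0 x"] by (simp add: L2_def)

lemma L2_norm_rep: "L2_norm x = sqrt (\<integral>t. (rep_L0 x t)\<^sup>2 \<partial>half_line)"
  using L2_norm.abs_eq[of "rep_L0 x"] by simp

lemma AE_rep_le_Linf_norm: "x \<in> Linf \<Longrightarrow> AE t in half_line. \<bar>rep_L0 x t\<bar> \<le> Linf_norm x"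
  using AE_abs_le[of "rep_L0 x" "Linf_norm x"] by (simp add: abs_esssup_eq)

lemma Linf_normI:
  assumes "AE t in half_line. \<bar>rep_L0 x t\<bar> \<le> b"
  shows "x \<in> Linf" "Linf_norm x \<le> b"
proof -
  have "abs_esssup x = esssup half_line (\<lambda>t. ereal \<bar>rep_L0 x t\<bar>)"
    using abs_esssup.abs_eq[of "rep_L0 x"] by simp
  also have "\<dots> \<le> ereal b"
    using assms by (intro esssup_I) auto
  finally show "x \<in> Linf" "Linf_norm x \<le> b"
    using Linf_norm_le_iff[of x b] by auto
qed

section \<open>Pointwise representatives of elements of the two spaces\<close>

definition cap_fun :: "L2_cap_Linf \<Rightarrow> real \<Rightarrow> real"
  where "cap_fun x = rep_L0 (Rep_L2_cap_Linf x)"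

definition plus_fun :: "L2_plus_Linf \<Rightarrow> real \<Rightarrow> real"
  where "plus_fun x = rep_L0 (Rep_L2_plus_Linf x)"

lemma cap_fun_measurable [measurable, simp]: "cap_fun x \<in> borel_measurable half_line"
  by (simp add: cap_fun_def)

lemma plus_fun_measurable [measurable, simp]: "plus_fun x \<in> borel_measurable half_line"
  by (simp add: plus_fun_def)

lemma AE_cap_fun_sum:
  assumes "finite I"
  shows "AE t in half_line. cap_fun (\<Sum>i\<in>I. c i *\<^sub>R x i) t = (\<Sum>i\<in>I. c i * cap_fun (x i) t)"
proof -
  have "Rep_L2_cap_Linf (\<Sum>i\<in>I. c i *\<^sub>R x i) = (\<Sum>i\<in>I. c i *\<^sub>R Rep_L2_cap_Linf (x i))"
    using assms by induction
      (simp_all add: zero_L2_cap_Linf.rep_eq plus_L2_cap_Linf.rep_eq scaleR_L2_cap_Linf.rep_eq)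
  then show ?thesis
    using AE_rep_L0_sum[OF assms] by (simp add: cap_fun_def)
qed

lemma AE_plus_fun_sum:
  assumes "finite I"
  shows "AE t in half_line. plus_fun (\<Sum>i\<in>I. c i *\<^sub>R x i) t = (\<Sum>i\<in>I. c i * plus_fun (x i) t)"
proof -
  have "Rep_L2_plus_Linf (\<Sum>i\<in>I. c i *\<^sub>R x i) = (\<Sum>i\<in>I. c i *\<^sub>R Rep_L2_plus_Linf (x i))"
    using assms by induction
      (simp_all add: zero_L2_plus_Linf.rep_eq plus_L2_plus_Linf.rep_eq scaleR_L2_plus_Linf.rep_eq)
  then show ?thesis
    using AE_rep_L0_sum[OF assms] by (simp add: plus_fun_def)
qed

lemma AE_plus_fun_add: "AE t in half_line. plus_fun (x + y) t = plus_fun x t + plus_fun y t"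
  using AE_plus_fun_sum[of "{False, True}" "\<lambda>_. 1" "\<lambda>b. if b then x else y"] by (simp add: ac_simps)

lemma AE_plus_fun_scaleR: "AE t in half_line. plus_fun (a *\<^sub>R x) t = a * plus_fun x t"
  using AE_plus_fun_sum[of "{()}" "\<lambda>_. a" "\<lambda>_. x"] by simp

lemma cap_fun_sq_integrable [simp]: "integrable half_line (\<lambda>t. (cap_fun x t)\<^sup>2)"
  using Rep_L2_cap_Linf[of x] by (simp add: cap_fun_def L2_iff_rep)

lemma cap_fun_integral_le: "(\<integral>t. (cap_fun x t)\<^sup>2 \<partial>half_line) \<le> (norm x)\<^sup>2"
proof -
  have "sqrt (\<integral>t. (cap_fun x t)\<^sup>2 \<partial>half_line) \<le> norm x"
    by (simp add: norm_L2_cap_Linf.rep_eq cap_norm_def L2_norm_rep cap_fun_def)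
  then show ?thesis by (rule sqrt_le_D)
qed

lemma AE_cap_fun_le_norm: "AE t in half_line. \<bar>cap_fun x t\<bar> \<le> norm x"
proof -
  have "AE t in half_line. \<bar>cap_fun x t\<bar> \<le> Linf_norm (Rep_L2_cap_Linf x)"
    using Rep_L2_cap_Linf[of x] unfolding cap_fun_def by (intro AE_rep_le_Linf_norm) simp
  then show ?thesis
    by eventually_elim (simp add: norm_L2_cap_Linf.rep_eq cap_norm_def)
qed

text \<open>The maximum is replaced by a sum so that the supremum part and the L2 part can later be
  summed over an index separately.\<close>

lemma norm_cap_le:
  assumes "AE t in half_line. \<bar>cap_fun x t\<bar> \<le> b" "0 \<le> b"
  shows "norm x \<le> b + sqrt (\<integral>t. (cap_fun x t)\<^sup>2 \<partial>half_line)"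
  using Linf_normI(2)[of "Rep_L2_cap_Linf x" b] assms
  by (simp add: norm_L2_cap_Linf.rep_eq cap_norm_def L2_norm_rep cap_fun_def add_increasing2)

lemma cap_fun_surj:
  assumes [measurable]: "f \<in> borel_measurable half_line"
    and b: "AE t in half_line. \<bar>f t\<bar> \<le> b" and int: "integrable half_line (\<lambda>t. (f t)\<^sup>2)"
  shows "\<exists>x. AE t in half_line. cap_fun x t = f t"
proof -
  have eq: "AE t in half_line. rep_L0 (abs_L0 f) t = f t"
    by (rule AE_rep_abs_L0) simp
  have "integrable half_line (\<lambda>t. (rep_L0 (abs_L0 f) t)\<^sup>2)"
    using eq by (intro integrable_cong_AE_imp[OF int]) (auto elim: eventually_mono)
  moreover have "AE t in half_line. \<bar>rep_L0 (abs_L0 f) t\<bar> \<le> b"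
    using eq b by eventually_elim simp
  ultimately have "abs_L0 f \<in> L2 \<inter> Linf"
    using Linf_normI(1) by (simp add: L2_iff_rep)
  then show ?thesis
    using eq by (auto simp: cap_fun_def Abs_L2_cap_Linf_inverse intro!: exI[of _ "Abs_L2_cap_Linf (abs_L0 f)"])
qed

text \<open>The trivial decomposition x = x + 0 is one competitor in the infimum; x = 0 + x gives
  the companion bound by the supremum.\<close>

lemma norm_plus_le_L2:
  assumes "integrable half_line (\<lambda>t. (plus_fun x t)\<^sup>2)"
  shows "norm x \<le> sqrt (\<integral>t. (plus_fun x t)\<^sup>2 \<partial>half_line)"
  using sum_norm_le[of "Rep_L2_plus_Linf x" 0] assms
  by (simp add: norm_L2_plus_Linf.rep_eq L2_iff_rep L2_norm_rep[symmetric] plus_fun_def)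

lemma norm_plus_le_sup:
  assumes "AE t in half_line. \<bar>plus_fun x t\<bar> \<le> b"
  shows "norm x \<le> b"
  using sum_norm_le[of 0 "Rep_L2_plus_Linf x"] Linf_normI[of "Rep_L2_plus_Linf x" b] assms
  by (simp add: norm_L2_plus_Linf.rep_eq plus_fun_def)

lemma plus_fun_surj:
  assumes [measurable]: "f \<in> borel_measurable half_line"
    and b: "AE t in half_line. \<bar>f t\<bar> \<le> b"
  shows "\<exists>x. AE t in half_line. plus_fun x t = f t"
proof -
  have eq: "AE t in half_line. rep_L0 (abs_L0 f) t = f t"
    by (rule AE_rep_abs_L0) simp
  have "AE t in half_line. \<bar>rep_L0 (abs_L0 f) t\<bar> \<le> b"
    using eq b by eventually_elim simp
  then have "abs_L0 f \<in> L2_sum_Linf"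
    using Linf_normI(1) L2_sum_LinfI[of 0 "abs_L0 f"] by simp
  then show ?thesis
    using eq by (auto simp: plus_fun_def Abs_L2_plus_Linf_inverse
        intro!: exI[of _ "Abs_L2_plus_Linf (abs_L0 f)"])
qed

text \<open>The infimum defining the norm need not be attained, so a decomposition is available only
  for a strictly larger \<open>c\<close>.\<close>

lemma plus_fun_decomp:
  assumes "norm x < c"
  obtains u v b where "u \<in> borel_measurable half_line" "v \<in> borel_measurable half_line"
    "integrable half_line (\<lambda>t. (u t)\<^sup>2)" "AE t in half_line. \<bar>v t\<bar> \<le> b"
    "AE t in half_line. plus_fun x t = u t + v t"
    "sqrt (\<integral>t. (u t)\<^sup>2 \<partial>half_line) + b < c" "0 \<le> b"
proof -
  obtain p q where pq: "p \<in> L2" "q \<in> Linf" "Rep_L2_plus_Linf x = p + q"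
      "L2_norm p + Linf_norm q < c"
    using sum_norm_obtain[OF Rep_L2_plus_Linf[of x], of c] assms
    by (auto simp: norm_L2_plus_Linf.rep_eq)
  show ?thesis
  proof (rule that)
    have "AE t in half_line. rep_L0 (p + q) t = rep_L0 p t + rep_L0 q t"
      using AE_rep_L0_sum[of "{False, True}" "\<lambda>_. 1" "\<lambda>b. if b then p else q"]
      by (simp add: ac_simps)
    then show "AE t in half_line. plus_fun x t = rep_L0 p t + rep_L0 q t"
      by (simp add: plus_fun_def pq(3))
    show "AE t in half_line. \<bar>rep_L0 q t\<bar> \<le> Linf_norm q"
      using pq by (intro AE_rep_le_Linf_norm)
  qed (use pq in \<open>simp_all add: L2_iff_rep L2_norm_rep\<close>)
qed


section \<open>Rademacher sums\<close>

text \<open>A choice of \<open>n\<close> signs is encoded by the set of indices with sign +1, so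
  \<open>Pow {..<n}\<close> with weights \<open>1 / 2 ^ n\<close> is the probability space of
  \<open>n\<close> independent Rademacher variables.\<close>

definition sign_of :: "nat set \<Rightarrow> nat \<Rightarrow> real"
  where "sign_of A j = (if j \<in> A then 1 else -1)"

lemma sign_of_sq [simp]: "(sign_of A j)\<^sup>2 = 1"
  by (simp add: sign_of_def)

text \<open>Conditioning on the last sign; this drives the inductions for the moments.\<close>

lemma sum_Pow_lessThan_Suc:
  "(\<Sum>A\<in>Pow {..<Suc n}. F A) = (\<Sum>A\<in>Pow {..<n}. F A + F (insert n A))"
proof -
  have "Pow {..<Suc n} = Pow {..<n} \<union> insert n ` Pow {..<n}"
    by (simp add: lessThan_Suc Pow_insert)
  moreover have "inj_on (insert n) (Pow {..<n})"
    by (rule inj_onI) (auto simp: insert_eq_iff)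
  moreover have "Pow {..<n} \<inter> insert n ` Pow {..<n} = {}"
    by auto
  ultimately show ?thesis
    by (simp add: sum.union_disjoint sum.reindex sum.distrib)
qed

lemma sum_sign_of_lessThan_Suc:
  assumes "A \<in> Pow {..<n}"
  shows "(\<Sum>j<Suc n. sign_of A j * a j) = (\<Sum>j<n. sign_of A j * a j) - a n"
    and "(\<Sum>j<Suc n. sign_of (insert n A) j * a j) = (\<Sum>j<n. sign_of A j * a j) + a n"
proof -
  have "n \<notin> A" using assms by auto
  then show "(\<Sum>j<Suc n. sign_of A j * a j) = (\<Sum>j<n. sign_of A j * a j) - a n"
    by (simp add: sign_of_def)
  have "(\<Sum>j<n. sign_of (insert n A) j * a j) = (\<Sum>j<n. sign_of A j * a j)"
    by (rule sum.cong) (auto simp: sign_of_def)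
  then show "(\<Sum>j<Suc n. sign_of (insert n A) j * a j) = (\<Sum>j<n. sign_of A j * a j) + a n"
    by (simp add: sign_of_def)
qed

lemma rademacher_second_moment:
  "(\<Sum>A\<in>Pow {..<n}. (\<Sum>j<n. sign_of A j * a j)\<^sup>2) = 2 ^ n * (\<Sum>j<n. (a j)\<^sup>2)"
proof (induction n)
  case (Suc n)
  have "(\<Sum>A\<in>Pow {..<Suc n}. (\<Sum>j<Suc n. sign_of A j * a j)\<^sup>2)
      = (\<Sum>A\<in>Pow {..<n}. 2 * (\<Sum>j<n. sign_of A j * a j)\<^sup>2 + 2 * (a n)\<^sup>2)"
    unfolding sum_Pow_lessThan_Suc
    by (intro sum.cong refl, simp only: sum_sign_of_lessThan_Suc)
      (simp add: power2_eq_square algebra_simps)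
  also have "\<dots> = 2 * (2 ^ n * (\<Sum>j<n. (a j)\<^sup>2)) + 2 ^ n * (2 * (a n)\<^sup>2)"
    by (simp add: sum.distrib sum_distrib_left[symmetric] Suc.IH card_Pow)
  finally show ?case by (simp add: algebra_simps)
qed simp

text \<open>Khinchine's inequality for exponent 4, by induction on the number of signs: averaging
  over the last sign cancels the odd powers of the new term.\<close>

lemma rademacher_fourth_moment:
  "(\<Sum>A\<in>Pow {..<n}. (\<Sum>j<n. sign_of A j * a j) ^ 4) \<le> 3 * 2 ^ n * (\<Sum>j<n. (a j)\<^sup>2)\<^sup>2"
proof (induction n)
  case (Suc n)
  define s where "s = (\<Sum>j<n. (a j)\<^sup>2)"
  have eq: "(S - b) ^ 4 + (S + b) ^ 4 = 2 * S ^ 4 + 12 * b\<^sup>2 * S\<^sup>2 + 2 * b ^ 4" for S b :: real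
    by (simp add: power4_eq_xxxx power2_eq_square algebra_simps)
  have "(\<Sum>A\<in>Pow {..<Suc n}. (\<Sum>j<Suc n. sign_of A j * a j) ^ 4)
      = (\<Sum>A\<in>Pow {..<n}. 2 * (\<Sum>j<n. sign_of A j * a j) ^ 4
          + 12 * (a n)\<^sup>2 * (\<Sum>j<n. sign_of A j * a j)\<^sup>2 + 2 * (a n) ^ 4)"
    unfolding sum_Pow_lessThan_Suc
    by (intro sum.cong refl, simp only: sum_sign_of_lessThan_Suc eq)
  also have "\<dots> = 2 * (\<Sum>A\<in>Pow {..<n}. (\<Sum>j<n. sign_of A j * a j) ^ 4)
      + 12 * (a n)\<^sup>2 * (2 ^ n * s) + 2 ^ n * (2 * (a n) ^ 4)"
    by (simp add: sum.distrib sum_distrib_left[symmetric] rademacher_second_moment card_Pow s_def)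
  \<comment> \<open>The coefficient 2 of the last fourth power is raised to 6 in order to complete
    the square.\<close>
  also have "\<dots> \<le> 2 * (3 * 2 ^ n * s\<^sup>2) + 12 * (a n)\<^sup>2 * (2 ^ n * s) + 2 ^ n * (6 * (a n) ^ 4)"
    using Suc.IH by (intro add_mono mult_left_mono) (simp_all add: s_def)
  also have "\<dots> = 3 * 2 ^ Suc n * (s + (a n)\<^sup>2)\<^sup>2"
    by (simp add: power4_eq_xxxx power2_eq_square algebra_simps)
  finally show ?case by (simp add: s_def)
qed simp

text \<open>The signs are orthonormal, and the claim is the nonnegativity of the mean square
  distance from \<open>E\<close> to its projection onto their span.\<close>

lemma rademacher_bessel:
  fixes E :: "nat set \<Rightarrow> real"
  shows "(\<Sum>j<n. ((\<Sum>A\<in>Pow {..<n}. sign_of A j * E A) / 2 ^ n)\<^sup>2) \<le> (\<Sum>A\<in>Pow {..<n}. (E A)\<^sup>2) / 2 ^ n"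
proof -
  define b where "b j = (\<Sum>A\<in>Pow {..<n}. sign_of A j * E A) / 2 ^ n" for j
  have "(\<Sum>A\<in>Pow {..<n}. E A * (\<Sum>j<n. sign_of A j * b j))
      = (\<Sum>j<n. b j * (\<Sum>A\<in>Pow {..<n}. sign_of A j * E A))"
    unfolding sum_distrib_left by (subst sum.swap) (simp add: ac_simps)
  also have "\<dots> = (\<Sum>j<n. b j * (2 ^ n * b j))"
    by (simp add: b_def)
  also have "\<dots> = 2 ^ n * (\<Sum>j<n. (b j)\<^sup>2)"
    by (simp add: sum_distrib_left power2_eq_square ac_simps)
  finally have cross: "(\<Sum>A\<in>Pow {..<n}. E A * (\<Sum>j<n. sign_of A j * b j)) = 2 ^ n * (\<Sum>j<n. (b j)\<^sup>2)" .
  have "0 \<le> (\<Sum>A\<in>Pow {..<n}. (E A - (\<Sum>j<n. sign_of A j * b j))\<^sup>2)"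
    by (simp add: sum_nonneg)
  also have "\<dots> = (\<Sum>A\<in>Pow {..<n}. (E A)\<^sup>2)
      - 2 * (\<Sum>A\<in>Pow {..<n}. E A * (\<Sum>j<n. sign_of A j * b j))
      + (\<Sum>A\<in>Pow {..<n}. (\<Sum>j<n. sign_of A j * b j)\<^sup>2)"
    by (simp add: power2_diff sum.distrib sum_subtractf sum_distrib_left[of 2] mult.assoc)
  also have "\<dots> = (\<Sum>A\<in>Pow {..<n}. (E A)\<^sup>2) - 2 ^ n * (\<Sum>j<n. (b j)\<^sup>2)"
    unfolding cross rademacher_second_moment by simp
  finally show ?thesis
    unfolding b_def[symmetric] by (simp add: field_simps)
qed

text \<open>For distinct indices, polarisation of the second moment: the coefficient vector is the
  indicator of the two indices.\<close>

lemma rademacher_orthogonal: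
  assumes "i < n" "j < n"
  shows "(\<Sum>A\<in>Pow {..<n}. sign_of A i * sign_of A j) = (if i = j then 2 ^ n else 0)"
proof (cases "i = j")
  case True
  then show ?thesis
    by (simp add: power2_eq_square[symmetric] card_Pow)
next
  case False
  define a where "a l = of_bool (l = i) + (of_bool (l = j) :: real)" for l
  have "(\<Sum>l<n. sign_of A l * a l) = sign_of A i + sign_of A j" for A
    using assms by (simp add: a_def algebra_simps sum.distrib)
  moreover have "(\<Sum>l<n. (a l)\<^sup>2) = 2"
  proof -
    have "(a l)\<^sup>2 = of_bool (l = i) + of_bool (l = j)" for l
      using False by (simp add: a_def)
    then show ?thesis
      using assms by (simp add: sum.distrib)
  qed
  ultimately have "(\<Sum>A\<in>Pow {..<n}. (sign_of A i + sign_of A j)\<^sup>2) = 2 ^ n * 2"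
    using rademacher_second_moment[of a n] by simp
  then show ?thesis
    using False by (simp add: power2_sum sum.distrib card_Pow sum_distrib_left[symmetric] ac_simps)
qed

text \<open>Orthogonality of the signs lets each vector be recovered from the family of all signed
  sums, so a splitting of the signed sums induces a splitting of the vectors.\<close>

lemma rademacher_coefficient:
  fixes a :: "nat \<Rightarrow> 'a :: real_vector"
  assumes "j < n"
  shows "(\<Sum>A\<in>Pow {..<n}. (sign_of A j / 2 ^ n) *\<^sub>R (\<Sum>i<n. sign_of A i *\<^sub>R a i)) = a j"
proof -
  have "(\<Sum>A\<in>Pow {..<n}. (sign_of A j / 2 ^ n) *\<^sub>R (\<Sum>i<n. sign_of A i *\<^sub>R a i))
      = (\<Sum>i<n. ((\<Sum>A\<in>Pow {..<n}. sign_of A i * sign_of A j) / 2 ^ n) *\<^sub>R a i)"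
    unfolding scaleR_sum_right sum_divide_distrib scaleR_sum_left
    by (subst sum.swap) (simp add: ac_simps)
  also have "\<dots> = (\<Sum>i<n. if i = j then a i else 0)"
    using assms by (intro sum.cong) (simp_all add: rademacher_orthogonal)
  finally show ?thesis using assms by simp
qed


section \<open>Complemented Hilbert subspaces of \<open>L2 \<inter> L_infinity\<close>\<close>

definition cap_sq :: "L2_cap_Linf \<Rightarrow> real"
  where "cap_sq x = (\<integral>t. (cap_fun x t)\<^sup>2 \<partial>half_line)"

lemma cap_sq_nonneg [simp]: "0 \<le> cap_sq x"
  by (simp add: cap_sq_def)

text \<open>Cauchy-Schwarz against the constant 1.\<close>

lemma sum_sqrt_le:
  assumes "\<And>i. i \<in> I \<Longrightarrow> 0 \<le> a i"
  shows "(\<Sum>i\<in>I. sqrt (a i)) \<le> sqrt (card I) * sqrt (\<Sum>i\<in>I. a i)"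
proof -
  have "(\<Sum>i\<in>I. sqrt (a i))\<^sup>2 \<le> (\<Sum>i\<in>I. (sqrt (a i))\<^sup>2) * card I"
    by (rule sum_squared_le_sum_of_squares)
  also have "\<dots> = card I * (\<Sum>i\<in>I. a i)"
    using assms by simp
  finally show ?thesis
    by (simp add: real_le_rsqrt real_sqrt_mult[symmetric])
qed

text \<open>The scalar second moment is applied at almost every point and then integrated.\<close>

lemma cap_sq_rademacher:
  "(\<Sum>A\<in>Pow {..<n}. cap_sq (\<Sum>j<n. sign_of A j *\<^sub>R y j)) = 2 ^ n * (\<Sum>j<n. cap_sq (y j))"
proof -
  have "AE t in half_line. \<forall>A\<in>Pow {..<n}. cap_fun (\<Sum>j<n. sign_of A j *\<^sub>R y j) t
      = (\<Sum>j<n. sign_of A j * cap_fun (y j) t)"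
    by (simp add: AE_finite_all AE_cap_fun_sum)
  then have "AE t in half_line. (\<Sum>A\<in>Pow {..<n}. (cap_fun (\<Sum>j<n. sign_of A j *\<^sub>R y j) t)\<^sup>2)
      = 2 ^ n * (\<Sum>j<n. (cap_fun (y j) t)\<^sup>2)"
    by eventually_elim (simp add: rademacher_second_moment)
  then have "(\<integral>t. (\<Sum>A\<in>Pow {..<n}. (cap_fun (\<Sum>j<n. sign_of A j *\<^sub>R y j) t)\<^sup>2) \<partial>half_line)
      = (\<integral>t. 2 ^ n * (\<Sum>j<n. (cap_fun (y j) t)\<^sup>2) \<partial>half_line)"
    by (intro integral_cong_AE) simp_all
  then show ?thesis
    by (simp add: cap_sq_def)
qed

section \<open>Truncation and the trace estimate\<close>

definition truncate :: "real \<Rightarrow> real \<Rightarrow> real"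
  where "truncate l x = max (- l) (min l x)"

lemma truncate_measurable [measurable]: "truncate l \<in> borel_measurable borel"
  unfolding truncate_def by measurable

lemma truncate_bounds:
  assumes "0 < l"
  shows "\<bar>truncate l x\<bar> \<le> l" "\<bar>truncate l x\<bar> \<le> \<bar>x\<bar>" "(x - truncate l x)\<^sup>2 \<le> x\<^sup>2"
    "(x - truncate l x)\<^sup>2 \<le> x ^ 4 / (16 * l\<^sup>2)"
proof -
  show "\<bar>truncate l x\<bar> \<le> l" "\<bar>truncate l x\<bar> \<le> \<bar>x\<bar>"
    using assms by (auto simp: truncate_def)
  show "(x - truncate l x)\<^sup>2 \<le> x\<^sup>2"
    using assms by (intro abs_le_square_iff[THEN iffD1]) (auto simp: truncate_def)
  have "\<bar>x - truncate l x\<bar> \<le> x\<^sup>2 / (4 * l)"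
  proof (cases "\<bar>x\<bar> \<le> l")
    case True
    then show ?thesis using assms by (simp add: truncate_def)
  next
    case False
    then have "\<bar>x - truncate l x\<bar> = \<bar>x\<bar> - l"
      using assms by (auto simp: truncate_def)
    \<comment> \<open>This is the expanded square of \<open>\<bar>x\<bar> - 2 * l\<close>. It trades
      the excess over height \<open>l\<close> for a higher power of \<open>x\<close>, which leads to
      the fourth moment.\<close>
    moreover have "4 * l * (\<bar>x\<bar> - l) \<le> x\<^sup>2"
      using zero_le_power2[of "\<bar>x\<bar> - 2 * l"] by (simp add: power2_eq_square algebra_simps)
    ultimately show ?thesis
      using assms by (simp add: pos_le_divide_eq mult.commute)
  qed
  then have "\<bar>x - truncate l x\<bar>\<^sup>2 \<le> (x\<^sup>2 / (4 * l))\<^sup>2"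
    by (rule power_mono) simp
  then show "(x - truncate l x)\<^sup>2 \<le> x ^ 4 / (16 * l\<^sup>2)"
    by (simp add: power_divide power_mult_distrib power_mult[symmetric])
qed

text \<open>The trace \<open>\<Sum>j<n. \<phi> j (y j)\<close> is split along the truncation at height \<open>l\<close> of the Rademacher
  sums of the \<open>y j\<close>: the truncated part is small because \<open>n\<close> signs only have norm \<open>sqrt n\<close>, the remainder
  because its fourth moments make its Rademacher coefficients of order \<open>1 / l\<close> in the supremum norm.\<close>

lemma trace_bound:
  fixes y :: "nat \<Rightarrow> L2_cap_Linf" and \<phi> :: "nat \<Rightarrow> L2_cap_Linf \<Rightarrow> real"
  assumes lin: "\<And>j. j < n \<Longrightarrow> linear (\<phi> j)"
    and phi: "\<And>x. (\<Sum>j<n. (\<phi> j x)\<^sup>2) \<le> (B * norm x)\<^sup>2"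
    and one: "\<And>j. j < n \<Longrightarrow> \<phi> j (y j) = 1"
    and ptw: "AE t in half_line. (\<Sum>j<n. (cap_fun (y j) t)\<^sup>2) \<le> C\<^sup>2"
    and pos: "0 \<le> B" "0 < l"
  shows "n \<le> B * sqrt n * (l + 2 * sqrt (\<Sum>j<n. cap_sq (y j))) + B * n * (C\<^sup>2 / (2 * l))"
proof -
  define D where "D = (\<Sum>j<n. cap_sq (y j))"
  define Y where "Y A = (\<Sum>j<n. sign_of A j *\<^sub>R y j)" for A
  have "\<exists>x. AE t in half_line. cap_fun x t = truncate l (cap_fun (Y A) t)" for A
  proof (rule cap_fun_surj)
    show "AE t in half_line. \<bar>truncate l (cap_fun (Y A) t)\<bar> \<le> l"
      using truncate_bounds(1)[OF pos(2)] by simp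
    show "integrable half_line (\<lambda>t. (truncate l (cap_fun (Y A) t))\<^sup>2)"
    proof (rule Bochner_Integration.integrable_bound[OF cap_fun_sq_integrable[of "Y A"]])
      show "AE t in half_line. norm ((truncate l (cap_fun (Y A) t))\<^sup>2) \<le> norm ((cap_fun (Y A) t)\<^sup>2)"
        using truncate_bounds(2)[OF pos(2)] by (simp add: abs_le_square_iff[symmetric])
    qed simp
  qed simp
  then obtain H where H: "\<And>A. AE t in half_line. cap_fun (H A) t = truncate l (cap_fun (Y A) t)"
    by metis
  define E where "E A = Y A - H A" for A
  \<comment> \<open>\<open>G j\<close> is the part of \<open>y j\<close> coming from the remainders:
    the \<open>j\<close>-th Rademacher coefficient of \<open>E\<close>. The rest of
    \<open>y j\<close> is the same coefficient of the truncations \<open>H\<close>.\<close>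
  define G where "G j = (\<Sum>A\<in>Pow {..<n}. (sign_of A j / 2 ^ n) *\<^sub>R E A)" for j
  have YE: "AE t in half_line. cap_fun (E A) t = cap_fun (Y A) t - truncate l (cap_fun (Y A) t)" for A
    using AE_cap_fun_sum[of "{False, True}" "\<lambda>b. if b then 1 else -1" "\<lambda>b. if b then Y A else H A"] H[of A]
    by (auto simp: E_def elim: eventually_elim2)
  have "AE t in half_line. \<forall>A\<in>Pow {..<n}. cap_fun (Y A) t = (\<Sum>j<n. sign_of A j * cap_fun (y j) t)"
    by (simp add: AE_finite_all AE_cap_fun_sum Y_def)
  moreover have "AE t in half_line. \<forall>A\<in>Pow {..<n}.
      cap_fun (E A) t = cap_fun (Y A) t - truncate l (cap_fun (Y A) t)"
    using YE by (simp add: AE_finite_all)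
  moreover have "AE t in half_line. \<forall>j\<in>{..<n}.
      cap_fun (G j) t = (\<Sum>A\<in>Pow {..<n}. (sign_of A j / 2 ^ n) * cap_fun (E A) t)"
    unfolding G_def by (intro AE_finite_allI AE_cap_fun_sum) simp_all
  \<comment> \<open>Bessel for the signs bounds both: with the remainder dominated by the full sum,
    the result integrates to an L2 bound; with the quartic bound on the remainder, it gives a
    supremum bound of order \<open>1 / l\<close>.\<close>
  ultimately have "AE t in half_line.
      (\<Sum>j<n. (cap_fun (G j) t)\<^sup>2) \<le> (\<Sum>j<n. (cap_fun (y j) t)\<^sup>2) \<and>
      (\<Sum>j<n. (cap_fun (G j) t)\<^sup>2) \<le> (C\<^sup>2 / (2 * l))\<^sup>2"
    using ptw
  proof eventually_elim
    case (elim t)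
    have g: "(\<Sum>j<n. (cap_fun (G j) t)\<^sup>2) \<le> (\<Sum>A\<in>Pow {..<n}. (cap_fun (E A) t)\<^sup>2) / 2 ^ n"
      using rademacher_bessel[of "\<lambda>A. cap_fun (E A) t" n] elim(3) by (simp add: sum_divide_distrib)
    also have "\<dots> \<le> (\<Sum>A\<in>Pow {..<n}. (cap_fun (Y A) t)\<^sup>2) / 2 ^ n"
      using elim(2) truncate_bounds(3)[OF pos(2)] by (intro divide_right_mono sum_mono) auto
    also have "\<dots> = (\<Sum>j<n. (cap_fun (y j) t)\<^sup>2)"
      using elim(1) by (simp add: rademacher_second_moment)
    finally have 1: "(\<Sum>j<n. (cap_fun (G j) t)\<^sup>2) \<le> (\<Sum>j<n. (cap_fun (y j) t)\<^sup>2)" .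
    note g
    also have "(\<Sum>A\<in>Pow {..<n}. (cap_fun (E A) t)\<^sup>2) / 2 ^ n
        \<le> (\<Sum>A\<in>Pow {..<n}. (cap_fun (Y A) t) ^ 4 / (16 * l\<^sup>2)) / 2 ^ n"
      using elim(2) truncate_bounds(4)[OF pos(2)] by (intro divide_right_mono sum_mono) auto
    also have "\<dots> = (\<Sum>A\<in>Pow {..<n}. (\<Sum>j<n. sign_of A j * cap_fun (y j) t) ^ 4) / (16 * l\<^sup>2 * 2 ^ n)"
      using elim(1) by (simp add: sum_divide_distrib)
    also have "\<dots> \<le> (3 * 2 ^ n * (\<Sum>j<n. (cap_fun (y j) t)\<^sup>2)\<^sup>2) / (16 * l\<^sup>2 * 2 ^ n)"
      by (intro divide_right_mono rademacher_fourth_moment) simp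
    also have "\<dots> \<le> (3 * 2 ^ n * (C\<^sup>2)\<^sup>2) / (16 * l\<^sup>2 * 2 ^ n)"
      using elim(4) by (intro divide_right_mono mult_left_mono power_mono) (simp_all add: sum_nonneg)
    \<comment> \<open>The constant 3/16 is rounded up to 1/4, a perfect square.\<close>
    also have "\<dots> \<le> (C\<^sup>2 / (2 * l))\<^sup>2"
      using pos by (simp add: power_divide power_mult_distrib field_simps)
    finally show ?case using 1 by simp
  qed
  then have G_le: "AE t in half_line. (\<Sum>j<n. (cap_fun (G j) t)\<^sup>2) \<le> (\<Sum>j<n. (cap_fun (y j) t)\<^sup>2)"
    and G_sup: "AE t in half_line. (\<Sum>j<n. (cap_fun (G j) t)\<^sup>2) \<le> (C\<^sup>2 / (2 * l))\<^sup>2"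
    by (auto elim: eventually_mono)
  have "(\<integral>t. (\<Sum>j<n. (cap_fun (G j) t)\<^sup>2) \<partial>half_line) \<le> (\<integral>t. (\<Sum>j<n. (cap_fun (y j) t)\<^sup>2) \<partial>half_line)"
    using G_le by (intro integral_mono_AE) simp_all
  then have G_D: "(\<Sum>j<n. cap_sq (G j)) \<le> D"
    by (simp add: cap_sq_def D_def)
  have G_norm: "norm (G j) \<le> C\<^sup>2 / (2 * l) + sqrt (cap_sq (G j))" if "j < n" for j
    unfolding cap_sq_def
  proof (rule norm_cap_le)
    show "AE t in half_line. \<bar>cap_fun (G j) t\<bar> \<le> C\<^sup>2 / (2 * l)"
      using G_sup
    proof eventually_elim
      case (elim t)
      have "(cap_fun (G j) t)\<^sup>2 \<le> (\<Sum>j<n. (cap_fun (G j) t)\<^sup>2)"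
        using that by (intro member_le_sum) auto
      then have "(cap_fun (G j) t)\<^sup>2 \<le> (C\<^sup>2 / (2 * l))\<^sup>2"
        using elim by simp
      then show ?case
        using pos by (intro power2_le_iff_abs_le[THEN iffD1]) simp_all
    qed
  qed (use pos in simp)
  have phi1: "\<phi> j x \<le> B * norm x" if "j < n" for j x
  proof -
    have "(\<phi> j x)\<^sup>2 \<le> (\<Sum>j<n. (\<phi> j x)\<^sup>2)"
      using that by (intro member_le_sum) auto
    then have "(\<phi> j x)\<^sup>2 \<le> (B * norm x)\<^sup>2"
      using phi[of x] by simp
    then show ?thesis
      using pos by (intro power2_le_imp_le[of "\<phi> j x"]) simp_all
  qed
  \<comment> \<open>Each functional is estimated separately: the supremum parts cost a factor
    \<open>n\<close>, which is affordable because of the \<open>1 / l\<close>, while Cauchy-Schwarz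
    reduces the L2 parts to \<open>sqrt n * sqrt D\<close>.\<close>
  have "(\<Sum>j<n. \<phi> j (G j)) \<le> (\<Sum>j<n. B * (C\<^sup>2 / (2 * l) + sqrt (cap_sq (G j))))"
    using pos by (intro sum_mono order_trans[OF phi1] mult_left_mono G_norm) auto
  also have "\<dots> = B * n * (C\<^sup>2 / (2 * l)) + B * (\<Sum>j<n. sqrt (cap_sq (G j)))"
    by (simp add: sum.distrib sum_distrib_left[symmetric] algebra_simps)
  also have "(\<Sum>j<n. sqrt (cap_sq (G j))) \<le> sqrt n * sqrt (\<Sum>j<n. cap_sq (G j))"
    using sum_sqrt_le[of "{..<n}" "\<lambda>j. cap_sq (G j)"] by simp
  also have "\<dots> \<le> sqrt n * sqrt D"
    using G_D by (intro mult_left_mono) simp_all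
  finally have partG: "(\<Sum>j<n. \<phi> j (G j)) \<le> B * n * (C\<^sup>2 / (2 * l)) + B * (sqrt n * sqrt D)"
    using pos by (simp add: mult_left_mono)
  have H_norm: "norm (H A) \<le> l + sqrt (cap_sq (Y A))" for A
  proof -
    have "norm (H A) \<le> l + sqrt (cap_sq (H A))"
      unfolding cap_sq_def
    proof (rule norm_cap_le)
      show "AE t in half_line. \<bar>cap_fun (H A) t\<bar> \<le> l"
        using H[of A] by eventually_elim (simp add: truncate_bounds pos)
    qed (use pos in simp)
    moreover have "cap_sq (H A) \<le> cap_sq (Y A)"
      unfolding cap_sq_def
    proof (rule integral_mono_AE)
      show "AE t in half_line. (cap_fun (H A) t)\<^sup>2 \<le> (cap_fun (Y A) t)\<^sup>2"
        using H[of A] by eventually_elim (simp add: truncate_bounds pos abs_le_square_iff[symmetric])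
    qed simp_all
    ultimately show ?thesis
      by (meson add_left_mono order_trans real_sqrt_le_mono)
  qed
  \<comment> \<open>Here the functionals are used jointly: a vector of \<open>n\<close> signs has
    Euclidean norm \<open>sqrt n\<close>, so the height \<open>l\<close> of the truncation is paid
    for with \<open>sqrt n\<close> only.\<close>
  have H_phi: "(\<Sum>j<n. sign_of A j * \<phi> j x) \<le> sqrt n * (B * norm x)" for A x
  proof -
    have "(\<Sum>j<n. sign_of A j * \<phi> j x)\<^sup>2 \<le> (\<Sum>j<n. (sign_of A j * \<phi> j x)\<^sup>2) * card {..<n}"
      by (rule sum_squared_le_sum_of_squares)
    also have "\<dots> = (\<Sum>j<n. (\<phi> j x)\<^sup>2) * n"
      by (simp add: power_mult_distrib)
    also have "\<dots> \<le> (B * norm x)\<^sup>2 * n"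
      by (intro mult_right_mono phi) simp
    also have "\<dots> = (sqrt n * (B * norm x))\<^sup>2"
      by (simp add: power_mult_distrib)
    finally show ?thesis
      using pos by (intro power2_le_imp_le[of "\<Sum>j<n. sign_of A j * \<phi> j x"]) simp_all
  qed
  have "(\<Sum>j<n. \<Sum>A\<in>Pow {..<n}. sign_of A j / 2 ^ n * \<phi> j (H A))
      = (\<Sum>A\<in>Pow {..<n}. (\<Sum>j<n. sign_of A j * \<phi> j (H A)) / 2 ^ n)"
    by (subst sum.swap) (simp add: sum_divide_distrib)
  also have "\<dots> \<le> (\<Sum>A\<in>Pow {..<n}. (sqrt n * (B * (l + sqrt (cap_sq (Y A))))) / 2 ^ n)"
    using pos by (intro sum_mono divide_right_mono order_trans[OF H_phi] mult_left_mono H_norm) simp_all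
  also have "\<dots> = sqrt n * B * (l + (\<Sum>A\<in>Pow {..<n}. sqrt (cap_sq (Y A))) / 2 ^ n)"
    by (simp add: sum_divide_distrib[symmetric] sum_distrib_left[symmetric] sum.distrib card_Pow
        add_divide_distrib distrib_left)
  also have "\<dots> \<le> sqrt n * B * (l + sqrt D)"
  proof -
    \<comment> \<open>Cauchy-Schwarz over the signs: the mean L2 norm of the signed sums is at most
      their root mean square \<open>sqrt D\<close>.\<close>
    have "(\<Sum>A\<in>Pow {..<n}. sqrt (cap_sq (Y A))) \<le> sqrt (2 ^ n) * sqrt (\<Sum>A\<in>Pow {..<n}. cap_sq (Y A))"
      using sum_sqrt_le[of "Pow {..<n}" "\<lambda>A. cap_sq (Y A)"] by (simp add: card_Pow)
    also have "\<dots> = 2 ^ n * sqrt D"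
      unfolding Y_def cap_sq_rademacher D_def[symmetric] by (simp add: real_sqrt_mult)
    finally show ?thesis
      using pos by (intro mult_left_mono add_left_mono) (simp_all add: field_simps)
  qed
  finally have partH: "(\<Sum>j<n. \<Sum>A\<in>Pow {..<n}. sign_of A j / 2 ^ n * \<phi> j (H A)) \<le> sqrt n * B * (l + sqrt D)" .
  have "real n = (\<Sum>j<n. \<phi> j (y j))"
    using one by simp
  also have "\<dots> = (\<Sum>j<n. \<phi> j (G j) + (\<Sum>A\<in>Pow {..<n}. sign_of A j / 2 ^ n * \<phi> j (H A)))"
  proof (rule sum.cong)
    fix j assume "j \<in> {..<n}"
    then have "y j = (\<Sum>A\<in>Pow {..<n}. (sign_of A j / 2 ^ n) *\<^sub>R Y A)"
      using rademacher_coefficient[of j n y] by (simp add: Y_def)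
    also have "\<dots> = G j + (\<Sum>A\<in>Pow {..<n}. (sign_of A j / 2 ^ n) *\<^sub>R H A)"
      by (simp add: G_def E_def sum.distrib[symmetric] scaleR_add_right[symmetric])
    finally have "\<phi> j (y j) = \<phi> j (G j + (\<Sum>A\<in>Pow {..<n}. (sign_of A j / 2 ^ n) *\<^sub>R H A))"
      by (rule arg_cong)
    then show "\<phi> j (y j) = \<phi> j (G j) + (\<Sum>A\<in>Pow {..<n}. sign_of A j / 2 ^ n * \<phi> j (H A))"
      using lin[of j] \<open>j \<in> {..<n}\<close> by (simp add: linear_add linear_sum linear_scale)
  qed simp
  also have "\<dots> \<le> (B * n * (C\<^sup>2 / (2 * l)) + B * (sqrt n * sqrt D)) + sqrt n * B * (l + sqrt D)"
    using partG partH by (simp add: sum.distrib)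
  finally show ?thesis
    by (simp add: D_def algebra_simps)
qed

text \<open>In the trace bound the two terms free of L2 norms can each be kept below a quarter of
  \<open>n\<close> once \<open>n\<close> is large, so the L2 norms have to account for the remaining
  half.\<close>

lemma cap_sq_lower_bound:
  fixes y :: "nat \<Rightarrow> L2_cap_Linf" and \<phi> :: "nat \<Rightarrow> L2_cap_Linf \<Rightarrow> real"
  assumes lin: "\<And>j. j < n \<Longrightarrow> linear (\<phi> j)"
    and phi: "\<And>x. (\<Sum>j<n. (\<phi> j x)\<^sup>2) \<le> (B * norm x)\<^sup>2"
    and one: "\<And>j. j < n \<Longrightarrow> \<phi> j (y j) = 1"
    and ptw: "AE t in half_line. (\<Sum>j<n. (cap_fun (y j) t)\<^sup>2) \<le> C\<^sup>2"
    and pos: "0 < B" "0 < C" and n: "(8 * B\<^sup>2 * C\<^sup>2)\<^sup>2 \<le> real n"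
  shows "n \<le> 16 * B\<^sup>2 * (\<Sum>j<n. cap_sq (y j))"
proof -
  define D where "D = (\<Sum>j<n. cap_sq (y j))"
  define s where "s = sqrt n"
  have s: "8 * B\<^sup>2 * C\<^sup>2 \<le> s" "s\<^sup>2 = n"
    using n by (simp_all add: s_def real_le_rsqrt)
  have s0: "0 < s"
    using pos by (intro less_le_trans[OF _ s(1)]) simp
  \<comment> \<open>The height \<open>l = 2 * B * C\<^sup>2\<close> makes the last term exactly
    \<open>n / 4\<close>; the size of \<open>n\<close> then makes the term \<open>B * s * l\<close>
    at most \<open>n / 4\<close> as well.\<close>
  have "n \<le> B * s * (2 * B * C\<^sup>2 + 2 * sqrt D) + B * n * (C\<^sup>2 / (2 * (2 * B * C\<^sup>2)))"
    unfolding D_def s_def using trace_bound[OF lin phi one ptw, of "2 * B * C\<^sup>2"] pos by simp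
  also have "\<dots> = s * (2 * B\<^sup>2 * C\<^sup>2) + s * (2 * B * sqrt D) + s\<^sup>2 / 4"
    using pos by (simp add: s(2)[symmetric] power2_eq_square field_simps)
  also have "\<dots> \<le> s * (s / 4) + s * (2 * B * sqrt D) + s\<^sup>2 / 4"
    using s s0 by (intro add_right_mono mult_left_mono) simp_all
  finally have "s * s \<le> s * (4 * B * sqrt D)"
    unfolding s(2)[symmetric] by (simp add: power2_eq_square)
  then have "s \<le> 4 * B * sqrt D"
    using s0 by simp
  then have "s\<^sup>2 \<le> (4 * B * sqrt D)\<^sup>2"
    using s0 by (intro power_mono) simp_all
  then show ?thesis
    by (simp add: s(2) D_def[symmetric] power_mult_distrib sum_nonneg) (simp add: D_def sum_nonneg)
qed


section \<open>Step functions in \<open>L2 + L_infinity\<close>\<close>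

text \<open>Half-open intervals of length \<open>1 / n\<close>, so that different slots are exactly
  disjoint and \<open>n\<close> consecutive ones starting at a multiple of \<open>n\<close> fill a
  unit interval.\<close>

definition slot :: "nat \<Rightarrow> nat \<Rightarrow> real set"
  where "slot n m = {real m / n <.. (real m + 1) / n}"

definition step :: "nat \<Rightarrow> nat \<Rightarrow> real \<Rightarrow> real"
  where "step n m t = sqrt n * indicator (slot n m) t"

lemma step_measurable [measurable, simp]: "step n m \<in> borel_measurable half_line"
  unfolding step_def[abs_def] slot_def
  by (intro measurable_restrict_space1 borel_measurable_times borel_measurable_const
      borel_measurable_indicator) simp

lemma slot_disjoint:
  assumes "0 < n"
  shows "disjoint_family_on (slot n) I"
  unfolding disjoint_family_on_def
proof (intro ballI impI)
  fix i j :: nat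
  assume "i \<noteq> j"
  show "slot n i \<inter> slot n j = {}"
  proof (rule ccontr)
    assume "slot n i \<inter> slot n j \<noteq> {}"
    then obtain t where t: "t \<in> slot n i" "t \<in> slot n j"
      by blast
    have *: "real m < t * n" "t * n \<le> real m + 1" if "t \<in> slot n m" for m
      using that assms by (simp_all add: slot_def field_simps)
    have "real i < real (Suc j)" "real j < real (Suc i)"
      using *[OF t(1)] *[OF t(2)] by simp_all
    then show False using \<open>i \<noteq> j\<close> by linarith
  qed
qed

text \<open>Block \<open>k\<close> lives on one unit interval, where the norm of the sum space
  dominates the L2 norm.\<close>

lemma slot_subset:
  assumes "j < n"
  shows "slot n (k * n + j) \<subseteq> {real k <.. real k + 1}"
proof
  fix t
  assume "t \<in> slot n (k * n + j)"
  then have t: "real k * n + j < t * n" "t * n \<le> real k * n + j + 1"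
    using assms by (simp_all add: slot_def field_simps)
  have "real j + 1 \<le> real n"
    using assms by linarith
  with t have "real k * n < t * n" "t * n \<le> real k * n + n"
    by linarith+
  then have "real k * n < t * n" "t * n \<le> (real k + 1) * n"
    by (simp_all add: distrib_right)
  then show "t \<in> {real k <.. real k + 1}"
    using assms by simp
qed

lemma step_sq: "(step n m t)\<^sup>2 = real n * indicator (slot n m) t"
  by (simp add: step_def power_mult_distrib indicator_def)

text \<open>Disjoint supports make all cross terms vanish pointwise.\<close>

lemma step_sum_sq:
  assumes "0 < n" "finite I"
  shows "(\<Sum>i\<in>I. c i * step n i t)\<^sup>2 = (\<Sum>i\<in>I. (c i)\<^sup>2 * (step n i t)\<^sup>2)"
proof -
  have zero: "step n i t * step n j t = 0" if "i \<noteq> j" for i j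
    using disjoint_family_onD[OF slot_disjoint[OF assms(1)], of i UNIV j] that
    by (auto simp: step_def indicator_def)
  have "(\<Sum>i\<in>I. c i * step n i t)\<^sup>2 = (\<Sum>i\<in>I. \<Sum>j\<in>I. c i * c j * (step n i t * step n j t))"
    by (simp add: power2_eq_square sum_product ac_simps)
  also have "\<dots> = (\<Sum>i\<in>I. \<Sum>j\<in>I. if i = j then (c i)\<^sup>2 * (step n i t)\<^sup>2 else 0)"
    by (intro sum.cong refl) (auto simp: zero power2_eq_square)
  finally show ?thesis
    using assms(2) by simp
qed

lemma sum_step_sq_le:
  assumes "0 < n" "finite I"
  shows "(\<Sum>i\<in>I. (step n i t)\<^sup>2) \<le> n"
proof -
  have "(\<Sum>i\<in>I. (step n i t)\<^sup>2) = real n * indicator (\<Union>(slot n ` I)) t"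
    by (simp add: step_sq sum_distrib_left[symmetric] indicator_UN_disjoint[OF assms(2) slot_disjoint[OF assms(1)]])
  then show ?thesis
    by (simp add: indicator_def)
qed

text \<open>At each point at most one step is nonzero, so the bound does not depend on how many
  steps are added.\<close>

lemma step_sum_bound:
  assumes "0 < n" "finite I" "\<And>i. i \<in> I \<Longrightarrow> (c i)\<^sup>2 \<le> 1"
  shows "\<bar>\<Sum>i\<in>I. c i * step n i t\<bar> \<le> sqrt n"
proof -
  have "(\<Sum>i\<in>I. c i * step n i t)\<^sup>2 \<le> (\<Sum>i\<in>I. 1 * (step n i t)\<^sup>2)"
    unfolding step_sum_sq[OF assms(1,2)] using assms(3) by (intro sum_mono mult_right_mono) auto
  also have "\<dots> \<le> n"
    using sum_step_sq_le[OF assms(1,2)] by simp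
  finally show ?thesis
    by (simp add: real_le_rsqrt)
qed

section \<open>Localisation to unit intervals and coefficient functionals\<close>

lemma half_line_indicator:
  assumes "0 \<le> a" "a \<le> b"
  shows "integrable half_line (indicator {a<..b} :: real \<Rightarrow> real)"
    and "(\<integral>t. indicator {a<..b} t \<partial>half_line) = b - a"
proof -
  have sub: "{a<..b} \<subseteq> {0<..}" using assms by auto
  then have sets: "{a<..b} \<in> sets half_line"
    by (simp add: sets_restrict_space_iff)
  have "emeasure half_line {a<..b} = emeasure lebesgue {a<..b}"
    using sub by (simp add: emeasure_restrict_space)
  then have em: "emeasure half_line {a<..b} = ennreal (b - a)"
    using assms by simp
  then show "integrable half_line (indicator {a<..b} :: real \<Rightarrow> real)"
    using sets by (simp add: integrable_indicator_iff Int_absorb2[OF sub])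
  show "(\<integral>t. indicator {a<..b} t \<partial>half_line) = b - a"
    using sets em assms sets.sets_into_space[OF sets]
    by (simp add: measure_def Int_absorb2)
qed

lemma step_sq_integral:
  assumes "0 < n"
  shows "integrable half_line (\<lambda>t. (step n m t)\<^sup>2)" "(\<integral>t. (step n m t)\<^sup>2 \<partial>half_line) = 1"
proof -
  have le: "real m / n \<le> (real m + 1) / n"
    by (simp add: divide_right_mono)
  show "integrable half_line (\<lambda>t. (step n m t)\<^sup>2)"
    unfolding step_sq slot_def by (intro integrable_mult_right half_line_indicator le) simp
  have "(\<integral>t. (step n m t)\<^sup>2 \<partial>half_line) = real n * (\<integral>t. indicator (slot n m) t \<partial>half_line)"
    unfolding step_sq by (rule integral_mult_right_zero)
  also have "\<dots> = real n * ((real m + 1) / n - real m / n)"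
    unfolding slot_def by (subst half_line_indicator(2)[OF _ le]) simp_all
  finally show "(\<integral>t. (step n m t)\<^sup>2 \<partial>half_line) = 1"
    using assms by (simp add: diff_divide_distrib[symmetric])
qed

text \<open>The interval has measure one, so the bounded part of any decomposition has L2 norm there
  at most its supremum norm, and the triangle inequality in L2 applies.\<close>

lemma plus_fun_local:
  fixes k :: nat
  defines "\<eta> \<equiv> indicator {real k <.. real k + 1} :: real \<Rightarrow> real"
  shows "integrable half_line (\<lambda>t. (plus_fun x t * \<eta> t)\<^sup>2)"
    and "(\<integral>t. (plus_fun x t * \<eta> t)\<^sup>2 \<partial>half_line) \<le> (norm x)\<^sup>2"
proof -
  have eta: "integrable half_line \<eta>" "(\<integral>t. \<eta> t \<partial>half_line) = 1"
    unfolding \<eta>_def using half_line_indicator[of "real k" "real k + 1"] by simp_all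
  have [measurable]: "\<eta> \<in> borel_measurable half_line"
    using eta(1) by (rule borel_measurable_integrable)
  have eta01: "\<eta> t = 0 \<or> \<eta> t = 1" for t
    by (simp add: \<eta>_def indicator_def)
  \<comment> \<open>Proved for every \<open>c\<close> above the norm, since near-optimal
    decompositions are all that is available; \<open>c\<close> then tends to the norm.\<close>
  have main: "integrable half_line (\<lambda>t. (plus_fun x t * \<eta> t)\<^sup>2) \<and>
      sqrt (\<integral>t. (plus_fun x t * \<eta> t)\<^sup>2 \<partial>half_line) \<le> c" if c: "norm x < c" for c
  proof -
    obtain u v b where [measurable]: "u \<in> borel_measurable half_line" "v \<in> borel_measurable half_line"
      and u: "integrable half_line (\<lambda>t. (u t)\<^sup>2)" and v: "AE t in half_line. \<bar>v t\<bar> \<le> b"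
      and uv: "AE t in half_line. plus_fun x t = u t + v t"
      and le: "sqrt (\<integral>t. (u t)\<^sup>2 \<partial>half_line) + b < c" and b: "0 \<le> b"
      using plus_fun_decomp[OF c] by blast
    have u_le: "(u t * \<eta> t)\<^sup>2 \<le> (u t)\<^sup>2" for t
      using eta01[of t] by auto
    have u1: "integrable half_line (\<lambda>t. (u t * \<eta> t)\<^sup>2)"
      by (rule Bochner_Integration.integrable_bound[OF u]) (simp_all add: u_le)
    have v_le: "AE t in half_line. (v t * \<eta> t)\<^sup>2 \<le> b\<^sup>2 * \<eta> t"
      using v
    proof eventually_elim
      case (elim t)
      then have "\<bar>v t\<bar>\<^sup>2 \<le> b\<^sup>2"
        by (intro power_mono) simp_all
      then show ?case using eta01[of t] by auto
    qed
    have v1: "integrable half_line (\<lambda>t. (v t * \<eta> t)\<^sup>2)"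
    proof (rule Bochner_Integration.integrable_bound)
      show "integrable half_line (\<lambda>t. b\<^sup>2 * \<eta> t)"
        using eta by simp
      show "AE t in half_line. norm ((v t * \<eta> t)\<^sup>2) \<le> norm (b\<^sup>2 * \<eta> t)"
        using v_le by eventually_elim simp
    qed simp
    have "(\<integral>t. (v t * \<eta> t)\<^sup>2 \<partial>half_line) \<le> (\<integral>t. b\<^sup>2 * \<eta> t \<partial>half_line)"
      using eta v1 v_le by (intro integral_mono_AE) simp_all
    then have v2: "sqrt (\<integral>t. (v t * \<eta> t)\<^sup>2 \<partial>half_line) \<le> b"
      using b by (simp add: eta real_le_lsqrt)
    have u2: "sqrt (\<integral>t. (u t * \<eta> t)\<^sup>2 \<partial>half_line) \<le> sqrt (\<integral>t. (u t)\<^sup>2 \<partial>half_line)"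
      by (intro real_sqrt_le_mono integral_mono u u1 u_le)
    have eq: "AE t in half_line. (u t * \<eta> t + v t * \<eta> t)\<^sup>2 = (plus_fun x t * \<eta> t)\<^sup>2"
      using uv by eventually_elim (simp add: distrib_right)
    have add: "integrable half_line (\<lambda>t. (u t * \<eta> t + v t * \<eta> t)\<^sup>2)"
      "sqrt (\<integral>t. (u t * \<eta> t + v t * \<eta> t)\<^sup>2 \<partial>half_line)
        \<le> sqrt (\<integral>t. (u t * \<eta> t)\<^sup>2 \<partial>half_line) + sqrt (\<integral>t. (v t * \<eta> t)\<^sup>2 \<partial>half_line)"
      using sq_integral_add[OF _ _ u1 v1] by simp_all
    have "(\<integral>t. (plus_fun x t * \<eta> t)\<^sup>2 \<partial>half_line) = (\<integral>t. (u t * \<eta> t + v t * \<eta> t)\<^sup>2 \<partial>half_line)"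
      using eq by (intro integral_cong_AE) (auto elim: eventually_mono)
    moreover have "integrable half_line (\<lambda>t. (plus_fun x t * \<eta> t)\<^sup>2)"
      by (rule integrable_cong_AE_imp[OF add(1)]) (use eq in simp_all)
    moreover have "sqrt (\<integral>t. (u t * \<eta> t + v t * \<eta> t)\<^sup>2 \<partial>half_line) \<le> c"
      using add(2) u2 v2 le by linarith
    ultimately show ?thesis
      by simp
  qed
  show "integrable half_line (\<lambda>t. (plus_fun x t * \<eta> t)\<^sup>2)"
    using main[of "norm x + 1"] by simp
  have "sqrt (\<integral>t. (plus_fun x t * \<eta> t)\<^sup>2 \<partial>half_line) \<le> norm x"
  proof (rule field_le_epsilon)
    fix e :: real
    assume "0 < e"
    then show "sqrt (\<integral>t. (plus_fun x t * \<eta> t)\<^sup>2 \<partial>half_line) \<le> norm x + e"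
      using main[of "norm x + e"] by simp
  qed
  then show "(\<integral>t. (plus_fun x t * \<eta> t)\<^sup>2 \<partial>half_line) \<le> (norm x)\<^sup>2"
    by (rule sqrt_le_D)
qed

text \<open>An inner product with a step; it is meaningful on the whole sum space because the step
  is supported in a unit interval, where every element is square integrable.\<close>

definition coef :: "nat \<Rightarrow> nat \<Rightarrow> L2_plus_Linf \<Rightarrow> real"
  where "coef n m x = (\<integral>t. plus_fun x t * step n m t \<partial>half_line)"

lemma plus_fun_step_local:
  assumes "j < n"
  shows "plus_fun x t * indicator {real k <.. real k + 1} t * step n (k * n + j) t
    = plus_fun x t * step n (k * n + j) t"
  using slot_subset[OF assms, of k] by (auto simp: step_def indicator_def)

lemma coef_integrable:
  assumes "j < n"
  shows "integrable half_line (\<lambda>t. plus_fun x t * step n (k * n + j) t)"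
proof -
  have [measurable]: "(indicator {real k <.. real k + 1} :: real \<Rightarrow> real) \<in> borel_measurable half_line"
    using half_line_indicator(1)[of "real k" "real k + 1"] by (intro borel_measurable_integrable) simp
  have "integrable half_line (\<lambda>t. plus_fun x t * indicator {real k <.. real k + 1} t * step n (k * n + j) t)"
    using assms by (intro sq_integrable_mult plus_fun_local step_sq_integral) simp_all
  then show ?thesis
    by (simp add: plus_fun_step_local[OF assms])
qed

lemma linear_coef:
  assumes "j < n"
  shows "linear (coef n (k * n + j))"
proof (rule linearI)
  note int = coef_integrable[OF assms, of _ k]
  fix x y and a :: real
  have "coef n (k * n + j) (x + y)
      = (\<integral>t. plus_fun x t * step n (k * n + j) t + plus_fun y t * step n (k * n + j) t \<partial>half_line)"
    unfolding coef_def using AE_plus_fun_add[of x y]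
    by (intro integral_cong_AE) (auto simp: distrib_right elim: eventually_mono)
  then show "coef n (k * n + j) (x + y) = coef n (k * n + j) x + coef n (k * n + j) y"
    by (simp add: int coef_def)
  have "coef n (k * n + j) (a *\<^sub>R x) = (\<integral>t. a * (plus_fun x t * step n (k * n + j) t) \<partial>half_line)"
    unfolding coef_def using AE_plus_fun_scaleR[of a x]
    by (intro integral_cong_AE) (auto elim: eventually_mono)
  then show "coef n (k * n + j) (a *\<^sub>R x) = a *\<^sub>R coef n (k * n + j) x"
    by (simp add: coef_def)
qed

lemma step_block_sum_sq:
  assumes "0 < n"
  shows "(\<Sum>j<n. c j * step n (k * n + j) t)\<^sup>2 = (\<Sum>j<n. (c j)\<^sup>2 * (step n (k * n + j) t)\<^sup>2)"
proof -
  have inj: "inj_on (\<lambda>j. k * n + j) {..<n}"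
    by (simp add: inj_on_def)
  show ?thesis
    \<comment> \<open>Subtracting \<open>k * n\<close> recovers the position \<open>j\<close> inside
      block \<open>k\<close>.\<close>
    using step_sum_sq[OF assms, of "(\<lambda>j. k * n + j) ` {..<n}" "\<lambda>m. c (m - k * n)" t]
    by (simp add: sum.reindex[OF inj])
qed

text \<open>Bessel's inequality for the orthonormal steps of one block, applied to the restriction
  \<open>p\<close> of \<open>x\<close> to the unit interval carrying that block.\<close>

lemma coef_bessel:
  assumes "0 < n"
  shows "(\<Sum>j<n. (coef n (k * n + j) x)\<^sup>2) \<le> (norm x)\<^sup>2"
proof -
  define p where "p t = plus_fun x t * indicator {real k <.. real k + 1} t" for t
  define a where "a j = coef n (k * n + j) x" for j
  define q where "q j = step n (k * n + j)" for j
  have pq: "integrable half_line (\<lambda>t. p t * q j t)" "(\<integral>t. p t * q j t \<partial>half_line) = a j" if "j < n" for j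
    unfolding p_def q_def a_def coef_def plus_fun_step_local[OF that]
    using coef_integrable[OF that] by simp_all
  have q: "integrable half_line (\<lambda>t. (q j t)\<^sup>2)" "(\<integral>t. (q j t)\<^sup>2 \<partial>half_line) = 1" for j
    using step_sq_integral[OF assms] by (simp_all add: q_def)
  have p: "integrable half_line (\<lambda>t. (p t)\<^sup>2)"
    unfolding p_def by (rule plus_fun_local)
  have "(p t - (\<Sum>j<n. a j * q j t))\<^sup>2
      = (p t)\<^sup>2 - 2 * (\<Sum>j<n. a j * (p t * q j t)) + (\<Sum>j<n. (a j)\<^sup>2 * (q j t)\<^sup>2)" for t
    unfolding power2_diff unfolding q_def step_block_sum_sq[OF assms]
    by (simp add: sum_distrib_left ac_simps)
  then have "0 \<le> (\<integral>t. (p t)\<^sup>2 - 2 * (\<Sum>j<n. a j * (p t * q j t)) + (\<Sum>j<n. (a j)\<^sup>2 * (q j t)\<^sup>2) \<partial>half_line)"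
    by (intro integral_nonneg_AE) (metis (mono_tags, lifting) AE_I2 zero_le_power2)
  also have "\<dots> = (\<integral>t. (p t)\<^sup>2 \<partial>half_line) - 2 * (\<Sum>j<n. a j * a j) + (\<Sum>j<n. (a j)\<^sup>2)"
  proof -
    have "integrable half_line (\<lambda>t. \<Sum>j<n. a j * (p t * q j t))"
      "integrable half_line (\<lambda>t. \<Sum>j<n. (a j)\<^sup>2 * (q j t)\<^sup>2)"
      by (intro Bochner_Integration.integrable_sum integrable_mult_right pq q; simp)+
    moreover have "(\<integral>t. (\<Sum>j<n. a j * (p t * q j t)) \<partial>half_line) = (\<Sum>j<n. a j * a j)"
      by (subst Bochner_Integration.integral_sum) (simp_all add: pq)
    moreover have "(\<integral>t. (\<Sum>j<n. (a j)\<^sup>2 * (q j t)\<^sup>2) \<partial>half_line) = (\<Sum>j<n. (a j)\<^sup>2)"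
      by (subst Bochner_Integration.integral_sum) (simp_all add: q)
    ultimately show ?thesis
      using p by simp
  qed
  finally have "(\<Sum>j<n. (a j)\<^sup>2) \<le> (\<integral>t. (p t)\<^sup>2 \<partial>half_line)"
    by (simp add: power2_eq_square)
  also have "\<dots> \<le> (norm x)\<^sup>2"
    unfolding p_def by (rule plus_fun_local)
  finally show ?thesis
    by (simp add: a_def)
qed

section \<open>From bounds on linear combinations to a pointwise square function\<close>

lemma floor_mult_divide_tendsto:
  fixes a :: real
  shows "(\<lambda>m. of_int \<lfloor>real (Suc m) * a\<rfloor> / real (Suc m)) \<longlonglongrightarrow> a"
proof (rule real_tendsto_sandwich)
  show "(\<lambda>m. a - inverse (real (Suc m))) \<longlonglongrightarrow> a"
    using tendsto_diff[OF tendsto_const[of a] LIMSEQ_inverse_real_of_nat] by simp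
  have "a - inverse (real (Suc m)) \<le> of_int \<lfloor>real (Suc m) * a\<rfloor> / real (Suc m)" for m
  proof -
    have "(real (Suc m) * a - 1) / real (Suc m) \<le> of_int \<lfloor>real (Suc m) * a\<rfloor> / real (Suc m)"
      by (intro divide_right_mono) linarith+
    then show ?thesis
      by (simp add: diff_divide_distrib inverse_eq_divide del: of_nat_Suc)
  qed
  then show "\<forall>\<^sub>F m in sequentially. a - inverse (real (Suc m)) \<le> of_int \<lfloor>real (Suc m) * a\<rfloor> / real (Suc m)"
    by simp
  have "of_int \<lfloor>real (Suc m) * a\<rfloor> / real (Suc m) \<le> a" for m
    using of_int_floor_le[of "real (Suc m) * a"]
    by (simp add: pos_divide_le_eq mult.commute del: of_nat_Suc)
  then show "\<forall>\<^sub>F m in sequentially. of_int \<lfloor>real (Suc m) * a\<rfloor> / real (Suc m) \<le> a"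
    by simp
qed simp

text \<open>Integer coefficients form a countable family, so that the hypothesis can be obtained for almost
  every point simultaneously.\<close>

lemma sum_sq_le_of_integer_duality:
  fixes a :: "nat \<Rightarrow> real"
  assumes "\<And>c :: int list. \<bar>\<Sum>j<n. real_of_int (c ! j) * a j\<bar> \<le> C * sqrt (\<Sum>j<n. (real_of_int (c ! j))\<^sup>2)"
    and "0 \<le> C"
  shows "(\<Sum>j<n. (a j)\<^sup>2) \<le> C\<^sup>2"
proof -
  define b where "b m j = real_of_int \<lfloor>real (Suc m) * a j\<rfloor> / real (Suc m)" for m j
  have b: "(\<lambda>m. b m j) \<longlonglongrightarrow> a j" for j
    unfolding b_def by (rule floor_mult_divide_tendsto)
  have le: "(\<Sum>j<n. b m j * a j) \<le> C * sqrt (\<Sum>j<n. (b m j)\<^sup>2)" for m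
  proof -
    \<comment> \<open>The approximations \<open>b m j\<close> share the denominator
      \<open>Suc m\<close>; clearing it yields integer coefficients, and both sides are homogeneous
      of degree one.\<close>
    define c where "c = map (\<lambda>j. \<lfloor>real (Suc m) * a j\<rfloor>) [0..<n]"
    have c: "real_of_int (c ! j) = real (Suc m) * b m j" if "j < n" for j
      using that by (simp add: c_def b_def)
    have "(\<Sum>j<n. real_of_int (c ! j) * a j) = real (Suc m) * (\<Sum>j<n. b m j * a j)"
      using c by (simp add: sum_distrib_left mult.assoc del: of_nat_Suc)
    moreover have "(\<Sum>j<n. (real_of_int (c ! j))\<^sup>2) = (real (Suc m))\<^sup>2 * (\<Sum>j<n. (b m j)\<^sup>2)"
      using c by (simp add: sum_distrib_left power_mult_distrib del: of_nat_Suc)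
    ultimately have "real (Suc m) * (\<Sum>j<n. b m j * a j) \<le> real (Suc m) * (C * sqrt (\<Sum>j<n. (b m j)\<^sup>2))"
      using abs_le_D1[OF assms(1)[of c]]
      by (simp add: real_sqrt_mult mult.left_commute[of C] del: of_nat_Suc mult_le_cancel_left_pos)
    then show ?thesis
      by (rule mult_left_le_imp_le) simp
  qed
  \<comment> \<open>In the limit the coefficients become \<open>a\<close> itself, the extremal
    choice in Euclidean duality; dividing by the norm of \<open>a\<close> finishes.\<close>
  have "(\<Sum>j<n. a j * a j) \<le> C * sqrt (\<Sum>j<n. (a j)\<^sup>2)"
  proof (rule LIMSEQ_le)
    show "(\<lambda>m. \<Sum>j<n. b m j * a j) \<longlonglongrightarrow> (\<Sum>j<n. a j * a j)"
      by (intro tendsto_intros b)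
    show "(\<lambda>m. C * sqrt (\<Sum>j<n. (b m j)\<^sup>2)) \<longlonglongrightarrow> C * sqrt (\<Sum>j<n. (a j)\<^sup>2)"
      by (intro tendsto_intros b)
  qed (use le in blast)
  moreover define s where "s = sqrt (\<Sum>j<n. (a j)\<^sup>2)"
  moreover have "s\<^sup>2 = (\<Sum>j<n. (a j)\<^sup>2)" "0 \<le> s"
    by (simp_all add: s_def sum_nonneg)
  ultimately have "s * s \<le> C * s" "0 \<le> s"
    by (simp_all add: power2_eq_square)
  then have "s \<le> C"
    using assms(2) by (cases "s = 0") simp_all
  then show ?thesis
    using \<open>0 \<le> s\<close> \<open>s\<^sup>2 = _\<close> by (metis power_mono)
qed

text \<open>Each coefficient vector gives a pointwise bound through the supremum part of the norm,
  off its own null set; integer lists are countable, so one null set serves them all, and duality at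
  each remaining point gives the square function.\<close>

lemma AE_square_function_le:
  fixes y :: "nat \<Rightarrow> L2_cap_Linf"
  assumes "\<And>c. norm (\<Sum>j<n. c j *\<^sub>R y j) \<le> C * sqrt (\<Sum>j<n. (c j)\<^sup>2)" "0 \<le> C"
  shows "AE t in half_line. (\<Sum>j<n. (cap_fun (y j) t)\<^sup>2) \<le> C\<^sup>2"
proof -
  have "AE t in half_line. \<bar>\<Sum>j<n. real_of_int (c ! j) * cap_fun (y j) t\<bar>
      \<le> C * sqrt (\<Sum>j<n. (real_of_int (c ! j))\<^sup>2)" for c
    using AE_cap_fun_sum[of "{..<n}" "\<lambda>j. real_of_int (c ! j)" y, simplified]
      AE_cap_fun_le_norm[of "\<Sum>j<n. real_of_int (c ! j) *\<^sub>R y j"]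
    by eventually_elim (use assms(1)[of "\<lambda>j. real_of_int (c ! j)"] in simp)
  then have "AE t in half_line. \<forall>c :: int list. \<bar>\<Sum>j<n. real_of_int (c ! j) * cap_fun (y j) t\<bar>
      \<le> C * sqrt (\<Sum>j<n. (real_of_int (c ! j))\<^sup>2)"
    by (simp add: AE_all_countable)
  then show ?thesis
    by eventually_elim (rule sum_sq_le_of_integer_duality; use assms(2) in simp)
qed


section \<open>Non-isomorphism\<close>

lemma no_linear_isomorphism:
  fixes T :: "L2_plus_Linf \<Rightarrow> L2_cap_Linf"
  assumes T: "linear T" and S: "linear S" and ST: "\<And>x. S (T x) = x"
    and C: "\<And>x. norm (T x) \<le> C * norm x" "0 < C"
    and B: "\<And>z. norm (S z) \<le> B * norm z" "0 < B"
  shows False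
proof -
  \<comment> \<open>\<open>n\<close> is fixed here, as the threshold of
    \<open>cap_sq_lower_bound\<close>; only the number \<open>N\<close> of blocks will grow.\<close>
  obtain n :: nat where n0: "max 1 ((8 * B\<^sup>2 * C\<^sup>2)\<^sup>2) \<le> real n"
    using real_arch_simple by blast
  then have n: "0 < n" "(8 * B\<^sup>2 * C\<^sup>2)\<^sup>2 \<le> real n"
    by auto
  have "\<exists>x. AE t in half_line. plus_fun x t = step n m t" for m
  proof (rule plus_fun_surj)
    show "AE t in half_line. \<bar>step n m t\<bar> \<le> sqrt n"
      by (simp add: step_def indicator_def)
  qed simp
  then obtain r where r: "\<And>m. AE t in half_line. plus_fun (r m) t = step n m t"
    by metis
  have AE_r: "AE t in half_line. plus_fun (\<Sum>i\<in>I. c i *\<^sub>R r (f i)) t = (\<Sum>i\<in>I. c i * step n (f i) t)"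
    if "finite I" for I and f :: "nat \<Rightarrow> nat" and c
  proof -
    have "AE t in half_line. \<forall>i\<in>I. plus_fun (r (f i)) t = step n (f i) t"
      using r that by (simp add: AE_finite_all)
    with AE_plus_fun_sum[OF that, of c "\<lambda>i. r (f i)"] show ?thesis
      by eventually_elim simp
  qed
  define y where "y m = T (r m)" for m
  have T_sum: "T (\<Sum>i\<in>I. c i *\<^sub>R r (f i)) = (\<Sum>i\<in>I. c i *\<^sub>R y (f i))" for I c and f :: "nat \<Rightarrow> nat"
    using T by (simp add: y_def linear_sum linear_scale)
  \<comment> \<open>Lower bound for each row of the array indexed by \<open>k\<close> and
    \<open>j\<close>; the functionals are the coefficients pulled back along
    \<open>S\<close>.\<close>
  have block: "n \<le> 16 * B\<^sup>2 * (\<Sum>j<n. cap_sq (y (k * n + j)))" for k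
  proof (rule cap_sq_lower_bound)
    let ?\<phi> = "\<lambda>j z. coef n (k * n + j) (S z)"
    show "linear (?\<phi> j)" if "j < n" for j
      using linear_compose[OF S linear_coef[OF that, of k]] by (simp add: o_def)
    show "(\<Sum>j<n. (?\<phi> j z)\<^sup>2) \<le> (B * norm z)\<^sup>2" for z
      using coef_bessel[OF n(1)] by (rule order_trans) (intro power_mono B norm_ge_zero)
    show "?\<phi> j (y (k * n + j)) = 1" if "j < n" for j
    proof -
      have "coef n (k * n + j) (r (k * n + j)) = (\<integral>t. (step n (k * n + j) t)\<^sup>2 \<partial>half_line)"
        unfolding coef_def using r[of "k * n + j"]
        by (intro integral_cong_AE) (auto simp: power2_eq_square elim: eventually_mono)
      then show ?thesis
        by (simp add: y_def ST step_sq_integral n)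
    qed
    show "AE t in half_line. (\<Sum>j<n. (cap_fun (y (k * n + j)) t)\<^sup>2) \<le> C\<^sup>2"
    proof (rule AE_square_function_le)
      fix c :: "nat \<Rightarrow> real"
      define x where "x = (\<Sum>j<n. c j *\<^sub>R r (k * n + j))"
      have eq: "AE t in half_line. (\<Sum>j<n. (c j)\<^sup>2 * (step n (k * n + j) t)\<^sup>2) = (plus_fun x t)\<^sup>2"
        using AE_r[of "{..<n}" c "\<lambda>j. k * n + j"] unfolding x_def
        by (auto simp: step_block_sum_sq[OF n(1)] elim: eventually_mono)
      have int: "integrable half_line (\<lambda>t. \<Sum>j<n. (c j)\<^sup>2 * (step n (k * n + j) t)\<^sup>2)"
        by (simp add: step_sq_integral n)
      have "integrable half_line (\<lambda>t. (plus_fun x t)\<^sup>2)"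
        by (rule integrable_cong_AE_imp[OF int]) (use eq in simp_all)
      then have "norm x \<le> sqrt (\<integral>t. (plus_fun x t)\<^sup>2 \<partial>half_line)"
        by (rule norm_plus_le_L2)
      also have "(\<integral>t. (plus_fun x t)\<^sup>2 \<partial>half_line)
          = (\<integral>t. (\<Sum>j<n. (c j)\<^sup>2 * (step n (k * n + j) t)\<^sup>2) \<partial>half_line)"
        using eq by (intro integral_cong_AE) (auto elim: eventually_mono)
      also have "\<dots> = (\<Sum>j<n. (c j)\<^sup>2)"
        by (simp add: step_sq_integral n)
      finally have "C * norm x \<le> C * sqrt (\<Sum>j<n. (c j)\<^sup>2)"
        using C(2) by simp
      then show "norm (\<Sum>j<n. c j *\<^sub>R y (k * n + j)) \<le> C * sqrt (\<Sum>j<n. (c j)\<^sup>2)"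
        using C(1)[of x] T_sum[of c "\<lambda>j. k * n + j" "{..<n}"] by (simp add: x_def)
    qed (use C in simp)
  qed (use B C n in simp_all)
  \<comment> \<open>Upper bound for each column, uniform in \<open>N\<close>: the signed sums stay
    bounded before \<open>T\<close> is applied, and averaging over the signs turns this into a bound
    on the sum of squares.\<close>
  have column: "(\<Sum>k<N. cap_sq (y (k * n + j))) \<le> C\<^sup>2 * n" for N j
  proof -
    have "cap_sq (\<Sum>k<N. sign_of A k *\<^sub>R y (k * n + j)) \<le> C\<^sup>2 * n" for A
    proof -
      define x where "x = (\<Sum>k<N. sign_of A k *\<^sub>R r (k * n + j))"
      have inj: "inj_on (\<lambda>k. k * n + j) {..<N}"
        using n by (simp add: inj_on_def)
      have "\<bar>\<Sum>k<N. sign_of A k * step n (k * n + j) t\<bar> \<le> sqrt n" for t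
        \<comment> \<open>For \<open>m = k * n + j\<close> the quotient \<open>(m - j) div n\<close>
          recovers the block number \<open>k\<close>.\<close>
        using step_sum_bound[OF n(1), of "(\<lambda>k. k * n + j) ` {..<N}" "\<lambda>m. sign_of A ((m - j) div n)" t] n
        by (simp add: sum.reindex[OF inj])
      then have "AE t in half_line. \<bar>plus_fun x t\<bar> \<le> sqrt n"
        using AE_r[of "{..<N}" "sign_of A" "\<lambda>k. k * n + j"] by (auto simp: x_def elim: eventually_mono)
      then have "norm x \<le> sqrt n"
        by (rule norm_plus_le_sup)
      then have "norm (T x) \<le> C * sqrt n"
        using C by (meson mult_left_mono less_imp_le order_trans)
      then have "(norm (T x))\<^sup>2 \<le> (C * sqrt n)\<^sup>2"
        by (intro power_mono) simp_all
      then have "cap_sq (T x) \<le> C\<^sup>2 * n"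
        using cap_fun_integral_le[of "T x"] by (simp add: cap_sq_def power_mult_distrib)
      then show ?thesis
        using T_sum[of "sign_of A" "\<lambda>k. k * n + j" "{..<N}"] by (simp add: x_def)
    qed
    then have "(\<Sum>A\<in>Pow {..<N}. cap_sq (\<Sum>k<N. sign_of A k *\<^sub>R y (k * n + j))) \<le> (\<Sum>A\<in>Pow {..<N}. C\<^sup>2 * n)"
      by (intro sum_mono)
    then show ?thesis
      by (simp add: cap_sq_rademacher card_Pow)
  qed
  obtain N :: nat where N: "16 * B\<^sup>2 * (C\<^sup>2 * n) < real N"
    using reals_Archimedean2 by blast
  \<comment> \<open>The total over \<open>N\<close> rows is counted twice: by rows it grows linearly
    in \<open>N\<close>, by columns it is bounded independently of \<open>N\<close>.\<close>
  have "real N * n \<le> (\<Sum>k<N. 16 * B\<^sup>2 * (\<Sum>j<n. cap_sq (y (k * n + j))))"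
    using sum_mono[of "{..<N}" "\<lambda>_. real n", OF block] by simp
  also have "\<dots> = 16 * B\<^sup>2 * (\<Sum>j<n. \<Sum>k<N. cap_sq (y (k * n + j)))"
    by (subst sum.swap) (simp add: sum_distrib_left)
  also have "\<dots> \<le> 16 * B\<^sup>2 * (\<Sum>j<n. C\<^sup>2 * n)"
    by (intro mult_left_mono sum_mono column) simp
  also have "\<dots> = 16 * B\<^sup>2 * (C\<^sup>2 * n) * n"
    by simp
  finally show False
    using N n by simp
qed

theorem theorem2:
  shows "\<not> (\<exists>T :: L2_plus_Linf \<Rightarrow> L2_cap_Linf.
            bounded_linear T \<and> bij T \<and> bounded_linear (inv T))"
proof
  assume "\<exists>T :: L2_plus_Linf \<Rightarrow> L2_cap_Linf. bounded_linear T \<and> bij T \<and> bounded_linear (inv T)"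
  then obtain T :: "L2_plus_Linf \<Rightarrow> L2_cap_Linf"
    where T: "bounded_linear T" "bij T" "bounded_linear (inv T)"
    by blast
  obtain C where "0 < C" "\<And>x. norm (T x) \<le> norm x * C"
    using bounded_linear.pos_bounded[OF T(1)] by blast
  moreover obtain B where "0 < B" "\<And>z. norm (inv T z) \<le> norm z * B"
    using bounded_linear.pos_bounded[OF T(3)] by blast
  ultimately show False
    using no_linear_isomorphism[of T "inv T" C B] T
    by (simp add: bounded_linear.linear bij_is_inj mult.commute)
qed

end
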